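(* For every computable perfect Polish space $X$ and $i\in\{0,2\}$, $$\mathsf{DBCT}_{i,X}\equiv_{\mathrm{sW}}\mathsf{BCT}_{i,X}.$$
   Context: Represented spaces and Weihrauch reducibility. The symbol $\subseteq$ in front of a domain means "possibly partial". A represented space $(X,\delta_X)$ is a set $X$ with a surjective partial map $\delta_X:\subseteq\mathbb N^{\mathbb N}\to X$. A multi-valued function $f:\subseteq X\rightrightarrows Y$ assigns to each $x\in\mathrm{dom}(f)$ a nonempty set $f(x)\subseteq Y$. A realizer $F\vdash f$ is a partial function $F:\subseteq\mathbb N^{\mathbb N}\to\mathbb N^{\mathbb N}$ with $\delta_YF(p)\in f(\delta_X(p))$ for all $p\in\mathrm{dom}(f\delta_X)$. $f\le_{\mathrm{sW}}g$: there are computable $K,H:\subseteq\mathbb N^{\mathbb N}\to\mathbb N^{\mathbb N}$ with $HGK\vdash f$ for all $G\vdash g$; $\equiv_{\mathrm{sW}}$ is reducibility in both directions. With $\langle p_0,p_1,\dots\rangle(\langle i,j\rangle):=p_i(j)$, the sequence space $X^{\mathbb N}$ is represented by $\delta_X^{\mathbb N}\langle p_0,p_1,\dots\rangle:=(\delta_X(p_i))_i$. A computable Polish space $(X,d,\alpha)$ is a complete metric space with a dense sequence $\alpha:\mathbb N\to X$ such that $d\circ(\alpha\times\alpha):\mathbb N^2\to\mathbb R$ is computable; it is perfect if it has no isolated points. The Cauchy representation is $\delta_X(p)=\lim_n\alpha(p(n))$, for those $p$ with $d(\alpha p(n),\alpha p(k))<2^{-k}$ for all $k$ and $n\ge k$.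 $X\sqcup\{\infty\}$ is $X$ with an additional isolated point $\infty$ at distance $1$ from all other points. $\mathcal A_-(X)$ is the set of closed subsets of $X$ with representation $\psi_-(p):=X\setminus\bigcup_iB_{p(i)}$, where $B_{\langle n,k\rangle}:=B(\alpha(n),\overline k)$ and $\overline k$ is the $k$-th rational in a standard enumeration. $\mathcal A_+(X)$ is the set of closed subsets of $X$ with representation $\psi_+(p)=A$ iff $\delta^{\mathbb N}_{X\sqcup\{\infty\}}(p)=(x_n)_n$ and $\overline{\{x_n:n\in\mathbb N\}}\cap X=A$. $\mathsf{BCT}_{0,X}:\subseteq\mathcal A_-(X)^{\mathbb N}\rightrightarrows X$ and $\mathsf{BCT}_{2,X}:\subseteq\mathcal A_+(X)^{\mathbb N}\rightrightarrows X$ both map $(A_i)_i$ to $X\setminus\bigcup_iA_i$, with domain all $(A_i)_i$ such that every $A_i$ has empty interior. $\mathsf{DBCT}_{0,X}:\subseteq\mathcal A_-(X)^{\mathbb N}\rightrightarrows X^{\mathbb N}$ and $\mathsf{DBCT}_{2,X}:\subseteq\mathcal A_+(X)^{\mathbb N}\rightrightarrows X^{\mathbb N}$ have the same domains and map $(A_i)_i$ to the set of all sequences $(x_i)_i$ that are dense in $X\setminus\bigcup_iA_i$ (i.e., sequences of points of this set that are dense in it). *)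

theory Defs
  imports "HOL-Analysis.Analysis" "HOL-Library.Nat_Bijection"
begin

section \<open>Computable partial functions on Baire space\<close>

text \<open>
  Terms for the \<open>\<mu>\<close>-recursive functions of any arity relative to an infinite sequence \<open>p\<close>,
  whose digits are read by \<open>Query\<close>.  \<open>computes p e xs y\<close> means that \<open>e\<close> halts on
  the arguments \<open>xs\<close> relative to \<open>p\<close> and returns \<open>y\<close>.
  In \<open>PrimRec\<close> and \<open>Mu\<close> the recursion (search) variable comes first.
\<close>

datatype rec_term =
    Zero
  | Succ
  | Proj nat
  | Query
  | Comp rec_term "rec_term list"
  | PrimRec rec_term rec_term
  | Mu rec_term

inductive computes :: "(nat \<Rightarrow> nat) \<Rightarrow> rec_term \<Rightarrow> nat list \<Rightarrow> nat \<Rightarrow> bool"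
  for p :: "nat \<Rightarrow> nat" where
  zero: "computes p Zero xs 0"
| succ: "computes p Succ (x # xs) (Suc x)"
| proj: "i < length xs \<Longrightarrow> computes p (Proj i) xs (xs ! i)"
| query: "computes p Query (x # xs) (p x)"
| comp: "list_all2 (\<lambda>g y. computes p g xs y) gs ys \<Longrightarrow> computes p f ys z \<Longrightarrow>
    computes p (Comp f gs) xs z"
| primrec_0: "computes p f xs y \<Longrightarrow> computes p (PrimRec f g) (0 # xs) y"
| primrec_Suc: "computes p (PrimRec f g) (n # xs) y \<Longrightarrow> computes p g (n # y # xs) z \<Longrightarrow>
    computes p (PrimRec f g) (Suc n # xs) z"
| mu: "computes p f (n # xs) 0 \<Longrightarrow> (\<And>i. i < n \<Longrightarrow> \<exists>y. computes p f (i # xs) (Suc y)) \<Longrightarrow>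
    computes p (Mu f) xs n"

text \<open>
  A type-2 machine for \<open>F\<close> produces the output \<open>F p\<close> digit by digit from the input \<open>p\<close>;
  equivalently, the digits of \<open>F p\<close> are computed by one program relative to \<open>p\<close>.  As usual for
  partial functions, there is no requirement on the program outside the domain of \<open>F\<close>.
\<close>

definition computable :: "((nat \<Rightarrow> nat) \<rightharpoonup> (nat \<Rightarrow> nat)) \<Rightarrow> bool" where
  "computable F \<longleftrightarrow> (\<exists>e. \<forall>p q. F p = Some q \<longrightarrow> (\<forall>n. computes p e [n] (q n)))"

section \<open>Represented spaces and strong Weihrauch reducibility\<close>

type_synonym 'x representation = "(nat \<Rightarrow> nat) \<rightharpoonup> 'x"

definition seq_rep :: "'x representation \<Rightarrow> (nat \<Rightarrow> 'x) representation" where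
  "seq_rep \<delta> p =
    (if \<forall>i. \<delta> (\<lambda>j. p (prod_encode (i, j))) \<noteq> None
     then Some (\<lambda>i. the (\<delta> (\<lambda>j. p (prod_encode (i, j))))) else None)"

text \<open>
  A multi-valued partial function between represented spaces; \<open>mvf f x = None\<close> encodes
  that \<open>x\<close> is outside the domain.
\<close>

record ('x, 'y) problem =
  in_rep :: "'x representation"
  out_rep :: "'y representation"
  mvf :: "'x \<rightharpoonup> 'y set"

definition realizes ::
    "((nat \<Rightarrow> nat) \<rightharpoonup> (nat \<Rightarrow> nat)) \<Rightarrow> ('x, 'y) problem \<Rightarrow> bool"  (infix "\<turnstile>" 50) where
  "F \<turnstile> f \<longleftrightarrow> (\<forall>p x Y. in_rep f p = Some x \<longrightarrow> mvf f x = Some Y \<longrightarrow>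
     (\<exists>q y. F p = Some q \<and> out_rep f q = Some y \<and> y \<in> Y))"

definition le_sW :: "('x, 'y) problem \<Rightarrow> ('u, 'v) problem \<Rightarrow> bool"  (infix "\<le>\<^sub>s\<^sub>W" 50) where
  "f \<le>\<^sub>s\<^sub>W g \<longleftrightarrow> (\<exists>K H. computable K \<and> computable H \<and>
     (\<forall>G. G \<turnstile> g \<longrightarrow> (H \<circ>\<^sub>m (G \<circ>\<^sub>m K)) \<turnstile> f))"

definition equiv_sW :: "('x, 'y) problem \<Rightarrow> ('u, 'v) problem \<Rightarrow> bool"  (infix "\<equiv>\<^sub>s\<^sub>W" 50) where
  "f \<equiv>\<^sub>s\<^sub>W g \<longleftrightarrow> f \<le>\<^sub>s\<^sub>W g \<and> g \<le>\<^sub>s\<^sub>W f"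

section \<open>Computable Polish spaces\<close>

text \<open>
  The distance is an explicit argument because the representation is also used
  for \<open>X \<squnion> {\<infinity>}\<close>.
\<close>

definition cauchy_rep :: "('x \<Rightarrow> 'x \<Rightarrow> real) \<Rightarrow> (nat \<Rightarrow> 'x) \<Rightarrow> 'x representation" where
  "cauchy_rep d \<alpha> p =
    (if (\<forall>k. \<forall>n\<ge>k. d (\<alpha> (p n)) (\<alpha> (p k)) < (1/2) ^ k) \<and>
        (\<exists>x. (\<lambda>n. d (\<alpha> (p n)) x) \<longlonglongrightarrow> 0)
     then Some (THE x. (\<lambda>n. d (\<alpha> (p n)) x) \<longlonglongrightarrow> 0) else None)"

text \<open>The rational number with index \<open>\<langle>\<langle>a, b\<rangle>, c\<rangle>\<close> is \<open>(a - b) / (c + 1)\<close>.\<close>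

definition rat_enum :: "nat \<Rightarrow> real" where
  "rat_enum k =
    (case prod_decode k of (m, c) \<Rightarrow> case prod_decode m of (a, b) \<Rightarrow>
       (real a - real b) / (real c + 1))"

text \<open>
  With \<open>\<delta>\<^sub>\<nat> p = p 0\<close>, this is the product representation for the interleaved pairing
  \<open>\<langle>p, q\<rangle> (2n) = p n\<close>, \<open>\<langle>p, q\<rangle> (2n+1) = q n\<close>.
\<close>

definition nat_pair_rep :: "(nat \<times> nat) representation" where
  "nat_pair_rep p = Some (p 0, p 1)"

definition computable_polish :: "(nat \<Rightarrow> 'a::complete_space) \<Rightarrow> bool" where
  "computable_polish \<alpha> \<longleftrightarrow>
     closure (range \<alpha>) = UNIV \<and>
     (\<exists>F. computable F \<and>
        F \<turnstile> \<lparr>in_rep = nat_pair_rep, out_rep = cauchy_rep dist rat_enum,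
             mvf = (\<lambda>(i, j). Some {dist (\<alpha> i) (\<alpha> j)})\<rparr>)"

text \<open>\<open>X \<squnion> {\<infinity>}\<close> with its dense sequence; \<open>None\<close> stands for \<open>\<infinity>\<close>.\<close>

fun dist_infty :: "'a::metric_space option \<Rightarrow> 'a option \<Rightarrow> real" where
  "dist_infty (Some x) (Some y) = dist x y"
| "dist_infty None None = 0"
| "dist_infty _ _ = 1"

fun seq_infty :: "(nat \<Rightarrow> 'a) \<Rightarrow> nat \<Rightarrow> 'a option" where
  "seq_infty \<alpha> 0 = None"
| "seq_infty \<alpha> (Suc n) = Some (\<alpha> n)"

section \<open>Representations of closed sets\<close>

definition psi_minus :: "(nat \<Rightarrow> 'a::metric_space) \<Rightarrow> 'a set representation" where
  "psi_minus \<alpha> p =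
     Some (- (\<Union>i. case prod_decode (p i) of (n, k) \<Rightarrow> ball (\<alpha> n) (rat_enum k)))"

text \<open>
  As \<open>\<infinity>\<close> is isolated, intersecting the closure of \<open>{x\<^sub>n}\<close> in \<open>X \<squnion> {\<infinity>}\<close> with \<open>X\<close> is the same as
  taking the closure in \<open>X\<close> of those \<open>x\<^sub>n\<close> that lie in \<open>X\<close>.
\<close>

definition psi_plus :: "(nat \<Rightarrow> 'a::metric_space) \<Rightarrow> 'a set representation" where
  "psi_plus \<alpha> p =
     map_option (\<lambda>x. closure {a. Some a \<in> range x})
       (seq_rep (cauchy_rep dist_infty (seq_infty \<alpha>)) p)"

section \<open>The Baire category problems\<close>

definition bct_map :: "(nat \<Rightarrow> 'a::metric_space set) \<rightharpoonup> 'a set" where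
  "bct_map A =
     (if \<forall>i. closed (A i) \<and> interior (A i) = {} then Some (- (\<Union>i. A i)) else None)"

definition dbct_map :: "(nat \<Rightarrow> 'a::metric_space set) \<rightharpoonup> (nat \<Rightarrow> 'a) set" where
  "dbct_map A =
     (if \<forall>i. closed (A i) \<and> interior (A i) = {}
      then Some {x. range x \<subseteq> - (\<Union>i. A i) \<and> - (\<Union>i. A i) \<subseteq> closure (range x)}
      else None)"

definition BCT0 :: "(nat \<Rightarrow> 'a::metric_space) \<Rightarrow> (nat \<Rightarrow> 'a set, 'a) problem" where
  "BCT0 \<alpha> = \<lparr>in_rep = seq_rep (psi_minus \<alpha>), out_rep = cauchy_rep dist \<alpha>, mvf = bct_map\<rparr>"

definition BCT2 :: "(nat \<Rightarrow> 'a::metric_space) \<Rightarrow> (nat \<Rightarrow> 'a set, 'a) problem" where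
  "BCT2 \<alpha> = \<lparr>in_rep = seq_rep (psi_plus \<alpha>), out_rep = cauchy_rep dist \<alpha>, mvf = bct_map\<rparr>"

definition DBCT0 :: "(nat \<Rightarrow> 'a::metric_space) \<Rightarrow> (nat \<Rightarrow> 'a set, nat \<Rightarrow> 'a) problem" where
  "DBCT0 \<alpha> =
     \<lparr>in_rep = seq_rep (psi_minus \<alpha>), out_rep = seq_rep (cauchy_rep dist \<alpha>), mvf = dbct_map\<rparr>"

definition DBCT2 :: "(nat \<Rightarrow> 'a::metric_space) \<Rightarrow> (nat \<Rightarrow> 'a set, nat \<Rightarrow> 'a) problem" where
  "DBCT2 \<alpha> =
     \<lparr>in_rep = seq_rep (psi_plus \<alpha>), out_rep = seq_rep (cauchy_rep dist \<alpha>), mvf = dbct_map\<rparr>"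

end

theory Submission
  imports Defs
begin

text \<open>
  A single point of a dense sequence of solutions is a solution, so \<open>BCT\<close> reduces to
  \<open>DBCT\<close>. For the converse, a strong reduction has to extract a whole dense sequence of
  solutions from one solution \<open>x\<close> of another instance, without access to the original
  instance. The idea is that a sufficiently generic point carries enough information. In Baire space
  one could split \<open>x\<close> into infinitely many sequences. For a general perfect space, an
  effective tree of open sets makes a generic \<open>x\<close> behave like an infinite binary
  sequence.

  The tree cuts the space by balls around the points \<open>\<alpha> c\<close>. For this to be
  effective, membership of \<open>\<alpha> n\<close> in the balls has to be decidable. This is
  achieved by taking as radii the numbers \<open>r / 2 ^ s\<close>, where \<open>r\<close> is a
  computable real that is diagonalised against all the distances (\<open>ex_generic_radius\<close>).
  Each node of the tree is an open region, a point belongs to at most one region of each length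
  (\<open>valid_unique\<close>), and every nonempty open set includes a region
  (\<open>ex_region_subset\<close>).

  The bits of \<open>x\<close> along the tree are instructions for infinitely many walkers, which move
  on the points \<open>\<alpha> c\<close> by steps that shrink geometrically. Walker
  \<open>\<langle>c, s\<rangle>\<close> starts at \<open>\<alpha> c\<close> and never leaves a ball of
  radius \<open>r / 2 ^ s\<close>, so the limits of the walkers are dense whatever \<open>x\<close>
  is. The bits following a given node can steer a given walker into any open set within the range of
  its next step (\<open>force_pos\<close>). Hence, if \<open>A i\<close> is nowhere dense, the points
  \<open>x\<close> which confine walker \<open>n\<close> to a ball disjoint from \<open>A i\<close>
  include a dense open set \<open>G\<close>. A point \<open>x\<close> in all these sets yields the
  required sequence (\<open>dbct_le_bct\<close>).

  It remains to compute nowhere dense closed sets that include the complements of these sets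
  \<open>G\<close>. If the \<open>A i\<close> are given by negative information, then the balls of
  \<open>G\<close> can be enumerated. If they are given by positive information, only the balls that
  do not belong to \<open>G\<close> can be recognised; nevertheless the complement of \<open>G\<close>
  has a nowhere dense superset with a computable dense sequence, whose points are chosen at most one
  for each basic ball and ever closer to the complement of \<open>G\<close>
  (\<open>sparse_cover\<close>).
\<close>

section \<open>Closure properties of the computable functions\<close>

text \<open>
  The value \<open>f x\<close> is computed, uniformly in \<open>x\<close>, from the finitely many
  numbers \<open>v x\<close>, \<open>v \<in> set vs\<close>, relative to the oracle
  \<open>orc x\<close>. The type \<open>'e\<close> of environments is arbitrary, so that oracles and
  arguments of any number can be packed into it; a bound variable is handled by passing to
  environments \<open>(i, x)\<close> and putting \<open>fst\<close> in front of the old variables.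
  With this convention the closure properties below are syntax-directed introduction rules.
\<close>

definition computed_from :: "('e \<Rightarrow> nat \<Rightarrow> nat) \<Rightarrow> ('e \<Rightarrow> nat) list \<Rightarrow> ('e \<Rightarrow> nat) \<Rightarrow> bool" where
  "computed_from orc vs f \<longleftrightarrow> (\<exists>t. \<forall>x. computes (orc x) t (map (\<lambda>v. v x) vs) (f x))"

lemma computed_trans:
  assumes "computed_from orc gs f" "\<And>g. g \<in> set gs \<Longrightarrow> computed_from orc vs g"
  shows "computed_from orc vs f"
proof -
  obtain t where t: "\<And>x. computes (orc x) t (map (\<lambda>g. g x) gs) (f x)"
    using assms(1) unfolding computed_from_def by blast
  have "\<forall>g. \<exists>s. g \<in> set gs \<longrightarrow> (\<forall>x. computes (orc x) s (map (\<lambda>v. v x) vs) (g x))"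
    using assms(2) unfolding computed_from_def by blast
  then obtain S where S: "\<And>g x. g \<in> set gs \<Longrightarrow> computes (orc x) (S g) (map (\<lambda>v. v x) vs) (g x)"
    by metis
  have "computes (orc x) (Comp t (map S gs)) (map (\<lambda>v. v x) vs) (f x)" for x
    by (rule computes.comp[OF _ t])
      (auto simp: list_all2_map1 list_all2_map2 list_all2_same intro: S)
  then show ?thesis unfolding computed_from_def by blast
qed

lemma computed_reindex:
  "computed_from orc vs f \<Longrightarrow> computed_from (\<lambda>x. orc (r x)) (map (\<lambda>v x. v (r x)) vs) (\<lambda>x. f (r x))"
  unfolding computed_from_def by (auto simp: computed_from_def o_def)

lemma computed_var: "v \<in> set vs \<Longrightarrow> computed_from orc vs v"
proof -
  assume "v \<in> set vs"
  then obtain i where i: "i < length vs" "vs ! i = v" by (auto simp: in_set_conv_nth)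
  then have "computes (orc x) (Proj i) (map (\<lambda>v. v x) vs) (v x)" for x
    using computes.proj[of i "map (\<lambda>v. v x) vs" "orc x"] by simp
  then show ?thesis unfolding computed_from_def by blast
qed

lemma computed_apply1:
  assumes "computed_from fst [\<lambda>z. snd z] (\<lambda>z. h (fst z) (snd z))" "computed_from orc vs f"
  shows "computed_from orc vs (\<lambda>x. h (orc x) (f x))"
  by (rule computed_trans[OF computed_reindex[OF assms(1), of "\<lambda>x. (orc x, f x)", simplified]])
    (use assms in auto)

lemma computed_apply2:
  assumes "computed_from fst [\<lambda>z. fst (snd z), \<lambda>z. snd (snd z)] (\<lambda>z. h (fst z) (fst (snd z)) (snd (snd z)))"
    "computed_from orc vs f" "computed_from orc vs g"
  shows "computed_from orc vs (\<lambda>x. h (orc x) (f x) (g x))"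
  by (rule computed_trans[OF computed_reindex[OF assms(1), of "\<lambda>x. (orc x, f x, g x)", simplified]])
    (use assms in auto)

lemma computed_apply3:
  assumes "computed_from fst [\<lambda>z. fst (snd z), \<lambda>z. fst (snd (snd z)), \<lambda>z. snd (snd (snd z))]
      (\<lambda>z. h (fst z) (fst (snd z)) (fst (snd (snd z))) (snd (snd (snd z))))"
    "computed_from orc vs f" "computed_from orc vs g" "computed_from orc vs k"
  shows "computed_from orc vs (\<lambda>x. h (orc x) (f x) (g x) (k x))"
  by (rule computed_trans[OF computed_reindex[OF assms(1), of "\<lambda>x. (orc x, f x, g x, k x)", simplified]])
    (use assms in auto)

named_theorems computed_intros

lemma computed_query [computed_intros]: "computed_from orc vs f \<Longrightarrow> computed_from orc vs (\<lambda>x. orc x (f x))"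
  by (rule computed_apply1[where h = "\<lambda>p. p"]) (auto simp: computed_from_def intro: computes.query)

lemma computed_Suc: "computed_from orc vs f \<Longrightarrow> computed_from orc vs (\<lambda>x. Suc (f x))"
  by (rule computed_apply1[where h = "\<lambda>p. Suc"]) (auto simp: computed_from_def intro: computes.succ)

lemma computed_const [computed_intros]: "computed_from orc vs (\<lambda>x. c)"
proof (induction c)
  case 0
  then show ?case by (auto simp: computed_from_def intro: computes.zero)
qed (rule computed_Suc)

declare computed_Suc [computed_intros]

text \<open>
  Primitive recursion: the step function lives over environments \<open>(i, (v, x))\<close> with the
  recursion variable \<open>i\<close> and the previous value \<open>v\<close>.
\<close>

lemma computed_rec_nat:
  assumes "computed_from orc vs b" "computed_from orc vs g"
    "computed_from (\<lambda>z. orc (snd (snd z))) (fst # (\<lambda>z. fst (snd z)) # map (\<lambda>v z. v (snd (snd z))) vs)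
       (\<lambda>z. s (fst z) (fst (snd z)) (snd (snd z)))"
  shows "computed_from orc vs (\<lambda>x. rec_nat (b x) (\<lambda>i r. s i r x) (g x))"
proof -
  obtain tb where tb: "\<And>x. computes (orc x) tb (map (\<lambda>v. v x) vs) (b x)"
    using assms(1) unfolding computed_from_def by blast
  obtain ts where ts: "\<And>i r x. computes (orc x) ts (i # r # map (\<lambda>v. v x) vs) (s i r x)"
    using assms(3) unfolding computed_from_def by (auto simp: o_def)
  have *: "computes (orc x) (PrimRec tb ts) (n # map (\<lambda>v. v x) vs) (rec_nat (b x) (\<lambda>i r. s i r x) n)"
    for n x
    by (induction n) (auto intro: computes.primrec_0 computes.primrec_Suc tb ts)
  have "computed_from orc (g # vs) (\<lambda>x. rec_nat (b x) (\<lambda>i r. s i r x) (g x))"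
    unfolding computed_from_def using * by auto
  then show ?thesis
    by (rule computed_trans) (use assms(2) in \<open>auto intro: computed_var\<close>)
qed

lemma computed_eq:
  "computed_from orc vs f \<Longrightarrow> (\<And>x. g x = f x) \<Longrightarrow> computed_from orc vs g"
  by (subgoal_tac "g = f") auto

lemma computed_pred: "computed_from orc vs f \<Longrightarrow> computed_from orc vs (\<lambda>x. f x - Suc 0)"
  apply (rule computed_eq[where f = "\<lambda>x. rec_nat 0 (\<lambda>i r. i) (f x)"])
  subgoal by (rule computed_rec_nat) (auto intro: computed_var computed_intros)
  subgoal for x by (cases "f x") auto
  done

lemma computed_add [computed_intros]: "computed_from orc vs f \<Longrightarrow> computed_from orc vs g \<Longrightarrow> computed_from orc vs (\<lambda>x. f x + g x)"
proof (rule computed_eq[where f = "\<lambda>x. rec_nat (f x) (\<lambda>i r. Suc r) (g x)"])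
  show "f x + g x = rec_nat (f x) (\<lambda>i r. Suc r) (g x)" for x
  proof -
    have "a + n = rec_nat a (\<lambda>i r. Suc r) n" for a n :: nat
      by (induction n) auto
    then show ?thesis .
  qed
qed (rule computed_rec_nat; auto intro!: computed_Suc intro: computed_var)

lemma computed_diff [computed_intros]: "computed_from orc vs f \<Longrightarrow> computed_from orc vs g \<Longrightarrow> computed_from orc vs (\<lambda>x. f x - g x)"
proof (rule computed_eq[where f = "\<lambda>x. rec_nat (f x) (\<lambda>i r. r - Suc 0) (g x)"])
  show "f x - g x = rec_nat (f x) (\<lambda>i r. r - Suc 0) (g x)" for x
  proof -
    have "a - n = rec_nat a (\<lambda>i r. r - Suc 0) n" for a n :: nat
      by (induction n) auto
    then show ?thesis .
  qed
qed (rule computed_rec_nat; auto intro!: computed_pred intro: computed_var)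

lemma computed_mult [computed_intros]: "computed_from orc vs f \<Longrightarrow> computed_from orc vs g \<Longrightarrow> computed_from orc vs (\<lambda>x. f x * g x)"
proof (rule computed_eq[where f = "\<lambda>x. rec_nat 0 (\<lambda>i r. r + f x) (g x)"])
  show "f x * g x = rec_nat 0 (\<lambda>i r. r + f x) (g x)" for x
  proof -
    have "a * n = rec_nat 0 (\<lambda>i r. r + a) n" for a n :: nat
      by (induction n) auto
    then show ?thesis .
  qed
  assume f: "computed_from orc vs f" and g: "computed_from orc vs g"
  have "computed_from (\<lambda>z. orc (snd (snd z))) (fst # (\<lambda>z. fst (snd z)) # map (\<lambda>v z. v (snd (snd z))) vs)
     (\<lambda>z. f (snd (snd z)))"
    by (rule computed_trans[OF computed_reindex[OF f, of "\<lambda>z. snd (snd z)"]]) (auto intro: computed_var)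
  then show "computed_from orc vs (\<lambda>x. rec_nat 0 (\<lambda>i r. r + f x) (g x))"
    by (intro computed_rec_nat computed_add computed_const g) (auto intro: computed_var)
qed

lemma computed_power [computed_intros]: "computed_from orc vs f \<Longrightarrow> computed_from orc vs (\<lambda>x. c ^ f x)"
proof (rule computed_eq[where f = "\<lambda>x. rec_nat 1 (\<lambda>i r. c * r) (f x)"])
  show "c ^ f x = rec_nat 1 (\<lambda>i r. c * r) (f x)" for x
  proof -
    have "c ^ n = rec_nat 1 (\<lambda>i r. c * r) n" for n :: nat
      by (induction n) auto
    then show ?thesis .
  qed
qed (intro computed_rec_nat computed_mult computed_const; auto intro: computed_var)

lemma computed_le [computed_intros]:
  "computed_from orc vs f \<Longrightarrow> computed_from orc vs g \<Longrightarrow> computed_from orc vs (\<lambda>x. of_bool (f x \<le> g x))"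
  by (rule computed_eq[where f = "\<lambda>x. 1 - (f x - g x)"], (intro computed_intros; assumption), auto)

lemma computed_less [computed_intros]:
  "computed_from orc vs f \<Longrightarrow> computed_from orc vs g \<Longrightarrow> computed_from orc vs (\<lambda>x. of_bool (f x < g x))"
  by (rule computed_eq[where f = "\<lambda>x. of_bool (Suc (f x) \<le> g x)"], (intro computed_intros; assumption), auto)

lemma computed_not [computed_intros]:
  "computed_from orc vs (\<lambda>x. of_bool (A x)) \<Longrightarrow> computed_from orc vs (\<lambda>x. of_bool (\<not> A x))"
  by (rule computed_eq[where f = "\<lambda>x. 1 - of_bool (A x)"], (intro computed_intros; assumption), auto)

lemma computed_conj [computed_intros]:
  "computed_from orc vs (\<lambda>x. of_bool (A x)) \<Longrightarrow> computed_from orc vs (\<lambda>x. of_bool (B x)) \<Longrightarrow>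
    computed_from orc vs (\<lambda>x. of_bool (A x \<and> B x))"
  by (rule computed_eq[where f = "\<lambda>x. of_bool (A x) * of_bool (B x)"], (intro computed_intros; assumption), auto)

lemma computed_disj [computed_intros]:
  "computed_from orc vs (\<lambda>x. of_bool (A x)) \<Longrightarrow> computed_from orc vs (\<lambda>x. of_bool (B x)) \<Longrightarrow>
    computed_from orc vs (\<lambda>x. of_bool (A x \<or> B x))"
  by (rule computed_eq[where f = "\<lambda>x. of_bool (\<not> (\<not> A x \<and> \<not> B x))"], (intro computed_intros; assumption), auto)

lemma computed_imp [computed_intros]:
  "computed_from orc vs (\<lambda>x. of_bool (A x)) \<Longrightarrow> computed_from orc vs (\<lambda>x. of_bool (B x)) \<Longrightarrow>
    computed_from orc vs (\<lambda>x. of_bool (A x \<longrightarrow> B x))"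
  by (rule computed_eq[where f = "\<lambda>x. of_bool (\<not> A x \<or> B x)"], (intro computed_intros; assumption), auto)

lemma computed_eq_nat [computed_intros]:
  "computed_from orc vs f \<Longrightarrow> computed_from orc vs g \<Longrightarrow> computed_from orc vs (\<lambda>x. of_bool (f x = g x))"
  by (rule computed_eq[where f = "\<lambda>x. of_bool (f x \<le> g x \<and> g x \<le> f x)"], (intro computed_intros; assumption), auto)

lemma computed_iff [computed_intros]:
  "computed_from orc vs (\<lambda>x. of_bool (A x)) \<Longrightarrow> computed_from orc vs (\<lambda>x. of_bool (B x)) \<Longrightarrow>
    computed_from orc vs (\<lambda>x. of_bool (A x \<longleftrightarrow> B x))"
  by (rule computed_eq[where f = "\<lambda>x. of_bool ((A x \<longrightarrow> B x) \<and> (B x \<longrightarrow> A x))"], (intro computed_intros; assumption), auto)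

lemma computed_if [computed_intros]:
  "computed_from orc vs (\<lambda>x. of_bool (A x)) \<Longrightarrow> computed_from orc vs f \<Longrightarrow> computed_from orc vs g \<Longrightarrow>
    computed_from orc vs (\<lambda>x. if A x then f x else g x)"
  by (rule computed_eq[where f = "\<lambda>x. of_bool (A x) * f x + of_bool (\<not> A x) * g x"], (intro computed_intros; assumption), auto)

lemma computed_all_less [computed_intros]:
  assumes "computed_from (\<lambda>z. orc (snd z)) (fst # map (\<lambda>v z. v (snd z)) vs) (\<lambda>z. of_bool (A (fst z) (snd z)))"
    and "computed_from orc vs b"
  shows "computed_from orc vs (\<lambda>x. of_bool (\<forall>i<b x. A i x))"
proof (rule computed_eq[where f = "\<lambda>x. rec_nat 1 (\<lambda>i r. r * of_bool (A i x)) (b x)"])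
  show "of_bool (\<forall>i<b x. A i x) = rec_nat (1::nat) (\<lambda>i r. r * of_bool (A i x)) (b x)" for x
  proof -
    have "of_bool (\<forall>i<n. P i) = rec_nat (1::nat) (\<lambda>i r. r * of_bool (P i)) n" for n and P
    proof (induction n)
      case (Suc n)
      have "(\<forall>i<Suc n. P i) \<longleftrightarrow> (\<forall>i<n. P i) \<and> P n" by (auto simp: less_Suc_eq)
      then show ?case by (simp only: of_bool_conj Suc) simp
    qed simp
    then show ?thesis .
  qed
  have "computed_from (\<lambda>z. orc (snd (snd z))) (fst # (\<lambda>z. fst (snd z)) # map (\<lambda>v z. v (snd (snd z))) vs)
     (\<lambda>z. of_bool (A (fst z) (snd (snd z))))"
    by (rule computed_trans[OF computed_reindex[OF assms(1), of "\<lambda>z. (fst z, snd (snd z))", simplified]])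
      (auto intro: computed_var)
  then show "computed_from orc vs (\<lambda>x. rec_nat 1 (\<lambda>i r. r * of_bool (A i x)) (b x))"
    by (intro computed_rec_nat computed_mult computed_const assms) (auto intro: computed_var)
qed

lemma computed_ex_less [computed_intros]:
  assumes "computed_from (\<lambda>z. orc (snd z)) (fst # map (\<lambda>v z. v (snd z)) vs) (\<lambda>z. of_bool (A (fst z) (snd z)))"
    and "computed_from orc vs b"
  shows "computed_from orc vs (\<lambda>x. of_bool (\<exists>i<b x. A i x))"
  by (rule computed_eq[where f = "\<lambda>x. of_bool (\<not> (\<forall>i<b x. \<not> A i x))"],
    intro computed_not computed_all_less assms, auto)

lemma computes_Least:
  assumes "\<And>i. computes p t (i # xs) (of_bool (\<not> A i))" "A k"
  shows "computes p (Mu t) xs (LEAST i. A i)"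
proof (rule computes.mu)
  show "computes p t ((LEAST i. A i) # xs) 0"
    using assms(1)[of "LEAST i. A i"] LeastI[of A, OF assms(2)] by simp
  show "\<exists>y. computes p t (i # xs) (Suc y)" if "i < (LEAST i. A i)" for i
    using assms(1)[of i] not_less_Least[OF that] by auto
qed

text \<open>
  Unbounded search stays within total functions as long as every search succeeds; the only genuinely
  partial search, in \<open>computable_search\<close>, is treated separately.
\<close>

lemma computed_Least:
  assumes "computed_from (\<lambda>z. orc (snd z)) (fst # map (\<lambda>v z. v (snd z)) vs) (\<lambda>z. of_bool (A (fst z) (snd z)))"
    and "\<And>x. \<exists>i. A i x"
  shows "computed_from orc vs (\<lambda>x. LEAST i. A i x)"
proof -
  obtain t where t: "\<And>i x. computes (orc x) t (i # map (\<lambda>v. v x) vs) (of_bool (\<not> A i x))"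
    using computed_not[OF assms(1)] unfolding computed_from_def by (auto simp: o_def)
  show ?thesis
    unfolding computed_from_def using computes_Least[OF t] assms(2) by blast
qed

section \<open>Pairs and lists\<close>

lemma computed_triangle: "computed_from orc vs f \<Longrightarrow> computed_from orc vs (\<lambda>x. triangle (f x))"
proof (rule computed_eq[where f = "\<lambda>x. rec_nat 0 (\<lambda>i r. r + Suc i) (f x)"])
  show "triangle (f x) = rec_nat 0 (\<lambda>i r. r + Suc i) (f x)" for x
  proof -
    have "triangle n = rec_nat 0 (\<lambda>i r. r + Suc i) n" for n :: nat
      by (induction n) auto
    then show ?thesis .
  qed
qed (intro computed_rec_nat computed_intros; auto intro: computed_var)

lemma computed_prod_encode [computed_intros]:
  "computed_from orc vs f \<Longrightarrow> computed_from orc vs g \<Longrightarrow> computed_from orc vs (\<lambda>x. prod_encode (f x, g x))"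
  unfolding prod_encode_def by (auto intro!: computed_intros computed_triangle)

definition pfst :: "nat \<Rightarrow> nat" where "pfst n = fst (prod_decode n)"
definition psnd :: "nat \<Rightarrow> nat" where "psnd n = snd (prod_decode n)"

lemma pfst_encode [simp]: "pfst (prod_encode (a, b)) = a"
  and psnd_encode [simp]: "psnd (prod_encode (a, b)) = b"
  and encode_pfst_psnd [simp]: "prod_encode (pfst n, psnd n) = n"
  by (auto simp: pfst_def psnd_def)

lemma pfst_le: "pfst n \<le> n" and psnd_le: "psnd n \<le> n"
  using le_prod_encode_1[of "pfst n" "psnd n"] le_prod_encode_2[of "psnd n" "pfst n"] by auto

lemma pfst_eq_Least: "pfst n = (LEAST a. \<exists>b<Suc n. prod_encode (a, b) = n)"
  by (rule Least_equality[symmetric])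
    (auto intro!: exI[of _ "psnd n"] simp: psnd_le less_Suc_eq_le)

lemma psnd_eq_Least: "psnd n = (LEAST b. \<exists>a<Suc n. prod_encode (a, b) = n)"
  by (rule Least_equality[symmetric])
    (auto intro!: exI[of _ "pfst n"] simp: pfst_le less_Suc_eq_le)

lemma computed_pfst [computed_intros]: "computed_from orc vs f \<Longrightarrow> computed_from orc vs (\<lambda>x. pfst (f x))"
proof (rule computed_apply1[where h = "\<lambda>_. pfst"])
  show "computed_from fst [\<lambda>z. snd z] (\<lambda>z. pfst (snd z))"
    unfolding pfst_eq_Least
  proof (rule computed_Least)
    show "\<exists>a. \<exists>b<Suc (snd x). prod_encode (a, b) = snd x" for x
      by (rule exI[of _ "pfst (snd x)"], rule exI[of _ "psnd (snd x)"])
        (simp add: psnd_le less_Suc_eq_le)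
  qed (rule computed_intros | (rule computed_var, simp; fail))+
qed

lemma computed_psnd [computed_intros]: "computed_from orc vs f \<Longrightarrow> computed_from orc vs (\<lambda>x. psnd (f x))"
proof (rule computed_apply1[where h = "\<lambda>_. psnd"])
  show "computed_from fst [\<lambda>z. snd z] (\<lambda>z. psnd (snd z))"
    unfolding psnd_eq_Least
  proof (rule computed_Least)
    show "\<exists>b. \<exists>a<Suc (snd x). prod_encode (a, b) = snd x" for x
      by (rule exI[of _ "psnd (snd x)"], rule exI[of _ "pfst (snd x)"])
        (simp add: pfst_le less_Suc_eq_le)
  qed (rule computed_intros | (rule computed_var, simp; fail))+
qed

definition code_drop :: "nat \<Rightarrow> nat \<Rightarrow> nat" where
  "code_drop i n = list_encode (drop i (list_decode n))"

definition code_hd :: "nat \<Rightarrow> nat" where "code_hd n = pfst (n - 1)"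

definition code_length :: "nat \<Rightarrow> nat" where "code_length n = length (list_decode n)"

lemma code_drop_eq: "code_drop i n = rec_nat n (\<lambda>_ r. psnd (r - 1)) i"
proof (induction i)
  case (Suc i)
  have tl: "list_encode (tl xs) = psnd (list_encode xs - 1)" for xs
    using psnd_le[of 0] by (cases xs) auto
  show ?case
    using Suc by (simp add: code_drop_def drop_Suc drop_tl tl)
qed (simp add: code_drop_def)

lemma computed_code_drop [computed_intros]:
  "computed_from orc vs f \<Longrightarrow> computed_from orc vs g \<Longrightarrow> computed_from orc vs (\<lambda>x. code_drop (f x) (g x))"
  unfolding code_drop_eq
  by (intro computed_rec_nat computed_intros; auto intro: computed_var)

lemma computed_code_hd [computed_intros]: "computed_from orc vs f \<Longrightarrow> computed_from orc vs (\<lambda>x. code_hd (f x))"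
  unfolding code_hd_def by (intro computed_intros)

lemma code_length_eq_Least: "code_length n = (LEAST i. code_drop i n = 0)"
proof (rule Least_equality[symmetric])
  have e: "list_encode xs = 0 \<longleftrightarrow> xs = []" for xs by (cases xs) auto
  show "code_drop (code_length n) n = 0" by (simp add: code_drop_def code_length_def)
  show "code_length n \<le> i" if "code_drop i n = 0" for i
    using that by (simp add: code_drop_def code_length_def e)
qed

lemma computed_code_length [computed_intros]: "computed_from orc vs f \<Longrightarrow> computed_from orc vs (\<lambda>x. code_length (f x))"
proof (rule computed_apply1[where h = "\<lambda>_. code_length"])
  show "computed_from fst [\<lambda>z. snd z] (\<lambda>z. code_length (snd z))"
    unfolding code_length_eq_Least
  proof (rule computed_Least)
    show "\<exists>i. code_drop i (snd x) = 0" for x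
      by (rule exI[of _ "code_length (snd x)"]) (simp add: code_drop_def code_length_def)
  qed (rule computed_intros | (rule computed_var, simp; fail))+
qed

section \<open>Substitution for the oracle\<close>

text \<open>
  Replaces the oracle by the program \<open>h\<close>, which depends on \<open>m\<close> parameters.
  The parameters are appended to every argument list, because \<open>PrimRec\<close>,
  \<open>Mu\<close>, \<open>Succ\<close> and \<open>Query\<close> address the front of the list. Their
  position is then the length \<open>a\<close> of the original argument list, which is why that length
  has to be carried along.
\<close>

fun subst_query :: "rec_term \<Rightarrow> nat \<Rightarrow> rec_term \<Rightarrow> nat \<Rightarrow> rec_term" where
  "subst_query h m Zero a = Zero"
| "subst_query h m Succ a = Succ"
| "subst_query h m (Proj i) a = Proj i"
| "subst_query h m Query a = Comp h (Proj 0 # map (\<lambda>i. Proj (a + i)) [0..<m])"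
| "subst_query h m (Comp f gs) a =
    Comp (subst_query h m f (length gs))
      (map (\<lambda>g. subst_query h m g a) gs @ map (\<lambda>i. Proj (a + i)) [0..<m])"
| "subst_query h m (PrimRec f g) a = PrimRec (subst_query h m f (a - 1)) (subst_query h m g (a + 1))"
| "subst_query h m (Mu f) a = Mu (subst_query h m f (a + 1))"

lemma computes_params:
  "list_all2 (\<lambda>g. computes p g (xs @ ps)) (map (\<lambda>i. Proj (length xs + i)) [0..<length ps]) ps"
proof -
  have "computes p (Proj (length xs + i)) (xs @ ps) (ps ! i)" if "i < length ps" for i
    using computes.proj[of "length xs + i" "xs @ ps" p] that by simp
  then show ?thesis by (auto simp: list_all2_conv_all_nth)
qed

lemma computes_subst_query:
  assumes h: "\<And>x. computes p h (x # ps) (p' x)"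
  shows "computes p' e xs y \<Longrightarrow> computes p (subst_query h (length ps) e (length xs)) (xs @ ps) y"
proof (induction rule: computes.induct)
  case (zero xs)
  then show ?case by (auto intro: computes.zero)
next
  case (succ x xs)
  then show ?case by (auto intro: computes.succ)
next
  case (proj i xs)
  then show ?case using computes.proj[of i "xs @ ps" p] by (simp add: nth_append)
next
  case (query x xs)
  show ?case
    using computes.proj[of 0 "x # xs @ ps" p] computes_params[of p "x # xs" ps]
    by (auto intro!: computes.comp[OF _ h])
next
  case (comp xs gs ys f z)
  have "length ys = length gs" using comp.IH(1) by (simp add: list_all2_lengthD)
  moreover have "list_all2 (\<lambda>g. computes p g (xs @ ps))
      (map (\<lambda>g. subst_query h (length ps) g (length xs)) gs) ys"
    using comp.IH(1) by (auto simp: list_all2_map1 elim!: list_all2_mono)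
  ultimately show ?case
    using comp.IH(2) computes_params[of p xs ps]
    by (auto intro!: computes.comp list_all2_appendI)
next
  case (primrec_0 f xs y g)
  then show ?case by (auto intro: computes.primrec_0)
next
  case (primrec_Suc f g n xs y z)
  then show ?case by (auto intro: computes.primrec_Suc)
next
  case (mu f n xs)
  then show ?case by (force intro: computes.mu)
qed

section \<open>Deciding comparisons of distances\<close>

lemma rat_enum_eq:
  "rat_enum k = (real (pfst (pfst k)) - real (psnd (pfst k))) / (real (psnd k) + 1)"
  by (simp add: rat_enum_def pfst_def psnd_def case_prod_unfold)

lemma cauchy_rep_dist:
  fixes \<alpha> :: "nat \<Rightarrow> 'a::metric_space"
  assumes "cauchy_rep dist \<alpha> p = Some x"
  shows "dist (\<alpha> (p k)) x \<le> (1/2) ^ k" and "(\<lambda>n. \<alpha> (p n)) \<longlonglongrightarrow> x"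
proof -
  have c: "\<forall>k. \<forall>n\<ge>k. dist (\<alpha> (p n)) (\<alpha> (p k)) < (1/2) ^ k"
    and e: "\<exists>x. (\<lambda>n. dist (\<alpha> (p n)) x) \<longlonglongrightarrow> 0"
    and x: "x = (THE x. (\<lambda>n. dist (\<alpha> (p n)) x) \<longlonglongrightarrow> 0)"
    using assms by (auto simp: cauchy_rep_def split: if_splits)
  obtain x' where x': "(\<lambda>n. dist (\<alpha> (p n)) x') \<longlonglongrightarrow> 0" using e by blast
  have "x = x'"
    unfolding x
  proof (rule the_equality)
    show "(\<lambda>n. dist (\<alpha> (p n)) x') \<longlonglongrightarrow> 0" by (fact x')
    show "y = x'" if "(\<lambda>n. dist (\<alpha> (p n)) y) \<longlonglongrightarrow> 0" for y
      using LIMSEQ_unique[OF iffD2[OF tendsto_dist_iff that] iffD2[OF tendsto_dist_iff x']] .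
  qed
  with x' have "(\<lambda>n. dist (\<alpha> (p n)) x) \<longlonglongrightarrow> 0" by simp
  then show l: "(\<lambda>n. \<alpha> (p n)) \<longlonglongrightarrow> x" by (rule iffD2[OF tendsto_dist_iff])
  have "(\<lambda>n. dist (\<alpha> (p n)) (\<alpha> (p k))) \<longlonglongrightarrow> dist x (\<alpha> (p k))"
    by (intro tendsto_intros l)
  then have "dist x (\<alpha> (p k)) \<le> (1/2) ^ k"
    by (rule LIMSEQ_le_const2) (use c in \<open>auto intro!: exI[of _ k] less_imp_le\<close>)
  then show "dist (\<alpha> (p k)) x \<le> (1/2) ^ k" by (simp add: dist_commute)
qed

text \<open>
  The hypothesis on \<open>\<alpha>\<close> yields a program that reads the two indices from its
  oracle. Substituting the oracle \<open>i, j, 0, 0, \<dots>\<close> makes the indices ordinary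
  arguments, so that the distances are approximated by one function of three numbers.
\<close>

lemma computable_polish_approx:
  fixes \<alpha> :: "nat \<Rightarrow> 'a::complete_space"
  assumes "computable_polish \<alpha>"
  obtains D where "computed_from fst [\<lambda>z. fst (snd z), \<lambda>z. fst (snd (snd z)), \<lambda>z. snd (snd (snd z))]
      (\<lambda>z. D (fst (snd z)) (fst (snd (snd z))) (snd (snd (snd z))))"
    "\<And>n i j. \<bar>rat_enum (D n i j) - dist (\<alpha> i) (\<alpha> j)\<bar> \<le> (1/2) ^ n"
proof -
  obtain F where F: "computable F" and R: "F \<turnstile> \<lparr>in_rep = nat_pair_rep, out_rep = cauchy_rep dist rat_enum,
             mvf = (\<lambda>(i, j). Some {dist (\<alpha> i) (\<alpha> j)})\<rparr>"
    using assms unfolding computable_polish_def by blast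
  obtain e where e: "\<And>p q n. F p = Some q \<Longrightarrow> computes p e [n] (q n)"
    using F unfolding computable_def by blast
  define P where "P = (\<lambda>i j x. if x = (0::nat) then i else if x = 1 then j else (0::nat))"
  define D where "D = (\<lambda>n i j. the (F (P i j)) n)"
  have "\<exists>q. F (P i j) = Some q \<and> cauchy_rep dist rat_enum q = Some (dist (\<alpha> i) (\<alpha> j))" for i j
    using R[unfolded realizes_def, simplified, rule_format, of "P i j" i j]
    by (auto simp: nat_pair_rep_def P_def)
  then have D: "F (P i j) = Some (\<lambda>n. D n i j)"
    "cauchy_rep dist rat_enum (\<lambda>n. D n i j) = Some (dist (\<alpha> i) (\<alpha> j))" for i j
    unfolding D_def by (metis option.sel)+
  have "computed_from fst [\<lambda>z. fst (snd z), \<lambda>z. fst (snd (snd z)), \<lambda>z. snd (snd (snd z))]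
      (\<lambda>z. if fst (snd z) = 0 then fst (snd (snd z)) else
        if fst (snd z) = 1 then snd (snd (snd z)) else 0)"
    by (rule computed_intros | (rule computed_var, simp; fail))+
  then obtain h where "\<And>z. computes (fst z) h
      (map (\<lambda>v. v z) [\<lambda>z. fst (snd z), \<lambda>z. fst (snd (snd z)), \<lambda>z. snd (snd (snd z))])
      (if fst (snd z) = 0 then fst (snd (snd z)) else
        if fst (snd z) = 1 then snd (snd (snd z)) else 0)"
    unfolding computed_from_def by blast
  note h' = this
  have h: "computes p h (x # [i, j]) (P i j x)" for p x i j
    using h'[of "(p, x, i, j)"] by (cases "x = 0"; cases "x = 1") (simp_all add: P_def)
  have "computes p (subst_query h (Suc (Suc 0)) e 1) [n, i, j] (D n i j)" for p n i j
    using computes_subst_query[OF h e[OF D(1)]] by simp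
  then have "computed_from fst [\<lambda>z. fst (snd z), \<lambda>z. fst (snd (snd z)), \<lambda>z. snd (snd (snd z))]
      (\<lambda>z. D (fst (snd z)) (fst (snd (snd z))) (snd (snd (snd z))))"
    unfolding computed_from_def by auto
  moreover have "\<bar>rat_enum (D n i j) - dist (\<alpha> i) (\<alpha> j)\<bar> \<le> (1/2) ^ n" for n i j
    using cauchy_rep_dist(1)[OF D(2)] by (simp add: dist_real_def)
  ultimately show ?thesis by (rule that)
qed

text \<open>
  A test \<open>m = \<langle>i, j, k, a, b, y\<rangle>\<close> asks whether the distance of
  \<open>\<alpha> i\<close> and \<open>\<alpha> j\<close> is below the \<open>k\<close>-th rational
  plus \<open>(a - b) / 2 ^ y\<close> times the radius \<open>r\<close>. All the comparisons of
  distances that occur later have this form.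
\<close>

definition test_i where "test_i m = pfst m"
definition test_j where "test_j m = pfst (psnd m)"
definition test_k where "test_k m = pfst (psnd (psnd m))"
definition test_a where "test_a m = pfst (psnd (psnd (psnd m)))"
definition test_b where "test_b m = pfst (psnd (psnd (psnd (psnd m))))"
definition test_y where "test_y m = psnd (psnd (psnd (psnd (psnd m))))"

lemmas test_defs = test_i_def test_j_def test_k_def test_a_def test_b_def test_y_def

definition bound :: "real \<Rightarrow> nat \<Rightarrow> real" where
  "bound r m = rat_enum (test_k m) + (real (test_a m) - real (test_b m)) / 2 ^ test_y m * r"

text \<open>
  The comparison of two rationals after multiplication by all the denominators and after moving the
  negative summands to the other side, so that it only uses arithmetic of natural numbers.
\<close>

definition below_mid :: "nat \<Rightarrow> nat \<Rightarrow> nat \<Rightarrow> nat \<Rightarrow> bool" where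
  "below_mid d m c t \<longleftrightarrow>
     (let k = test_k m; W = 2 ^ test_y m * (2 * 4 ^ t); V = (2 * c + 1) * (psnd d + 1) * (psnd k + 1) in
       pfst (pfst d) * (psnd k + 1) * W + psnd (pfst k) * (psnd d + 1) * W + test_b m * V
     < psnd (pfst d) * (psnd k + 1) * W + pfst (pfst k) * (psnd d + 1) * W + test_a m * V)"

lemma below_mid_iff:
  "below_mid d m c t \<longleftrightarrow> rat_enum d < bound ((2 * real c + 1) / (2 * 4 ^ t)) m"
proof -
  define d1 d2 d3 where "d1 = real (pfst (pfst d))" and "d2 = real (psnd (pfst d))" and "d3 = real (psnd d) + 1"
  define k1 k2 k3 where "k1 = real (pfst (pfst (test_k m)))" and "k2 = real (psnd (pfst (test_k m)))"
    and "k3 = real (psnd (test_k m)) + 1"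
  define a b where "a = real (test_a m)" and "b = real (test_b m)"
  define Y T where "Y = (2::real) ^ test_y m" and "T = (4::real) ^ t"
  define C where "C = 2 * real c + 1"
  have pos: "d3 > 0" "k3 > 0" "Y > 0" "T > 0"
    by (auto simp: d3_def k3_def Y_def T_def)
  define N where "N = d3 * k3 * Y * (2 * T)"
  have N: "N > 0" using pos by (simp add: N_def)
  have "below_mid d m c t \<longleftrightarrow> real (pfst (pfst d) * (psnd (test_k m) + 1) * (2 ^ test_y m * (2 * 4 ^ t)) +
       psnd (pfst (test_k m)) * (psnd d + 1) * (2 ^ test_y m * (2 * 4 ^ t)) +
       test_b m * ((2 * c + 1) * (psnd d + 1) * (psnd (test_k m) + 1)))
     < real (psnd (pfst d) * (psnd (test_k m) + 1) * (2 ^ test_y m * (2 * 4 ^ t)) +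
       pfst (pfst (test_k m)) * (psnd d + 1) * (2 ^ test_y m * (2 * 4 ^ t)) +
       test_a m * ((2 * c + 1) * (psnd d + 1) * (psnd (test_k m) + 1)))"
    unfolding below_mid_def Let_def of_nat_less_iff ..
  also have "\<dots> \<longleftrightarrow> d1 * k3 * (Y * (2 * T)) + k2 * d3 * (Y * (2 * T)) + b * (C * d3 * k3)
      < d2 * k3 * (Y * (2 * T)) + k1 * d3 * (Y * (2 * T)) + a * (C * d3 * k3)"
    by (simp only: of_nat_add of_nat_mult of_nat_power of_nat_numeral of_nat_1
        d1_def d2_def d3_def k1_def k2_def k3_def a_def b_def Y_def T_def C_def)
  also have "\<dots> \<longleftrightarrow> N * ((d1 - d2) / d3) < N * ((k1 - k2) / k3 + (a - b) / Y * (C / (2 * T)))"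
  proof -
    have A: "N * ((d1 - d2) / d3) = (d1 - d2) * k3 * (Y * (2 * T))"
      using pos by (simp add: N_def field_simps)
    have B: "N * ((k1 - k2) / k3 + (a - b) / Y * (C / (2 * T))) =
        (k1 - k2) * d3 * (Y * (2 * T)) + (a - b) * (C * d3 * k3)"
      using pos by (simp add: N_def divide_simps) (simp add: algebra_simps)?
    show ?thesis by (simp only: A B left_diff_distrib) linarith
  qed
  also have "\<dots> \<longleftrightarrow> rat_enum d < bound ((2 * real c + 1) / (2 * 4 ^ t)) m"
    using N unfolding mult_less_cancel_left_pos[OF N]
    by (simp add: rat_enum_eq bound_def d1_def d2_def d3_def k1_def k2_def k3_def a_def b_def Y_def T_def C_def)
  finally show ?thesis .
qed

text \<open>
  A test with \<open>a = b\<close> does not involve \<open>r\<close> and cannot be decided in general;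
  it is made to fail.
\<close>

definition dist_below :: "(nat \<Rightarrow> 'a::metric_space) \<Rightarrow> real \<Rightarrow> nat \<Rightarrow> bool" where
  "dist_below \<alpha> r m \<longleftrightarrow> test_a m \<noteq> test_b m \<and> dist (\<alpha> (test_i m)) (\<alpha> (test_j m)) < bound r m"

text \<open>
  Comparing a computable real with a given number is undecidable only because of equality. The radius
  is therefore diagonalised against all the tests: the interval
  \<open>[c t / 4 ^ t, (c t + 1) / 4 ^ t]\<close> that contains \<open>r\<close> is replaced by its
  first or last quarter, whichever an approximation shows to be on the safe side of the
  \<open>t\<close>-th critical value. The choice made at stage \<open>t\<close> answers the
  \<open>t\<close>-th test, so that all tests become decidable and none of them is ever an equality.
\<close>

theorem ex_generic_radius:
  fixes \<alpha> :: "nat \<Rightarrow> 'a::complete_space"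
  assumes "computable_polish \<alpha>"
  obtains r where "1 \<le> r" "r \<le> 2"
    "\<And>m. test_a m \<noteq> test_b m \<Longrightarrow> dist (\<alpha> (test_i m)) (\<alpha> (test_j m)) \<noteq> bound r m"
    "computed_from fst [\<lambda>z. snd z] (\<lambda>z. of_bool (dist_below \<alpha> r (snd z)))"
proof -
  obtain D where D: "computed_from fst [\<lambda>z. fst (snd z), \<lambda>z. fst (snd (snd z)), \<lambda>z. snd (snd (snd z))]
      (\<lambda>z. D (fst (snd z)) (fst (snd (snd z))) (snd (snd (snd z))))"
    and D_approx: "\<And>n i j. \<bar>rat_enum (D n i j) - dist (\<alpha> i) (\<alpha> j)\<bar> \<le> (1/2) ^ n"
    using computable_polish_approx[OF assms] by blast
  \<comment> \<open>the error is then at most an eighth of the length of the interval at stage \<open>t\<close>, times the coefficient of \<open>r\<close>\<close>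
  define d where "d = (\<lambda>t. D (2 * t + 3 + test_y t) (test_i t) (test_j t))"
  define g where "g = (\<lambda>t c. below_mid (d t) t c t)"
  \<comment> \<open>if the test holds, \<open>r\<close> must move up when its coefficient is positive and down when it is negative\<close>
  define c where "c = rec_nat 1 (\<lambda>t r. 4 * r + (if g t r \<longleftrightarrow> test_b t < test_a t then 3 else 0))"
  have c0: "c 0 = 1" and cS: "c (Suc t) = 4 * c t + (if g t (c t) \<longleftrightarrow> test_b t < test_a t then 3 else 0)" for t
    by (simp_all add: c_def)
  define lo hi where "lo = (\<lambda>t. real (c t) / 4 ^ t)" and "hi = (\<lambda>t. (real (c t) + 1) / 4 ^ t)"
  have lo_mono: "s \<le> t \<Longrightarrow> lo s \<le> lo t" and hi_mono: "s \<le> t \<Longrightarrow> hi t \<le> hi s" for s t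
  proof -
    have "lo t \<le> lo (Suc t)" "hi (Suc t) \<le> hi t" for t
      by (simp_all add: lo_def hi_def cS field_simps)
    then show "s \<le> t \<Longrightarrow> lo s \<le> lo t" "s \<le> t \<Longrightarrow> hi t \<le> hi s"
      by (auto intro: lift_Suc_mono_le lift_Suc_antimono_le)
  qed
  have lohi: "lo s \<le> hi t" for s t
  proof -
    have "lo s \<le> lo (max s t)" by (rule lo_mono) simp
    also have "\<dots> \<le> hi (max s t)" by (simp add: lo_def hi_def divide_right_mono)
    also have "\<dots> \<le> hi t" by (rule hi_mono) simp
    finally show ?thesis .
  qed
  define r where "r = (SUP t. lo t)"
  have "bdd_above (range lo)" using lohi[of _ 0] by (auto intro!: bdd_aboveI)
  then have r: "lo t \<le> r" "r \<le> hi t" for t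
    unfolding r_def using lohi by (auto intro!: cSUP_upper cSUP_least)
  have key: "dist (\<alpha> (test_i t)) (\<alpha> (test_j t)) \<noteq> bound r t \<and>
      (g t (c t) \<longleftrightarrow> dist (\<alpha> (test_i t)) (\<alpha> (test_j t)) < bound r t)" if ab: "test_a t \<noteq> test_b t" for t
  proof -
    define \<delta> where "\<delta> = dist (\<alpha> (test_i t)) (\<alpha> (test_j t))"
    define q where "q = (real (test_a t) - real (test_b t)) / 2 ^ test_y t"
    define e where "e = (1::real) / 4 ^ t"
    define mid where "mid = (2 * real (c t) + 1) / (2 * 4 ^ t)"
    have "(1/2) ^ (2 * t + 3 + test_y t) = e / 8 / 2 ^ test_y t"
      by (simp add: e_def power_add power_mult power_divide)
    then have err: "\<bar>rat_enum (d t) - \<delta>\<bar> \<le> e / 8 / 2 ^ test_y t"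
      using D_approx[of "2 * t + 3 + test_y t" "test_i t" "test_j t"] by (simp add: d_def \<delta>_def)
    have "1 \<le> \<bar>real (test_a t) - real (test_b t)\<bar>" using ab by linarith
    then have "1 / 2 ^ test_y t \<le> \<bar>q\<bar>" by (simp add: q_def abs_divide divide_right_mono)
    have e0: "e > 0" by (simp add: e_def)
    have "e / 8 / 2 ^ test_y t = (e / 8) * (1 / 2 ^ test_y t)" by simp
    also have "\<dots> \<le> (e / 8) * \<bar>q\<bar>"
      using e0 \<open>1 / 2 ^ test_y t \<le> \<bar>q\<bar>\<close> by (intro mult_left_mono) auto
    finally have err': "\<bar>rat_enum (d t) - \<delta>\<bar> \<le> e / 8 * \<bar>q\<bar>" using err by linarith
    have g: "g t (c t) \<longleftrightarrow> rat_enum (d t) < rat_enum (test_k t) + q * mid"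
      by (simp add: g_def below_mid_iff bound_def q_def mid_def)
    have q0: "q > 0 \<longleftrightarrow> test_b t < test_a t" "q \<noteq> 0"
      using ab by (auto simp: q_def zero_less_divide_iff)
    define Q where "Q = e * \<bar>q\<bar>"
    have eq0: "0 < Q" using e0 q0 by (simp add: Q_def)
    have up: "r \<ge> mid + e / 4" if "g t (c t) \<longleftrightarrow> test_b t < test_a t"
    proof -
      have "mid + e / 4 = (4 * real (c t) + 3) / (4 * 4 ^ t)"
        by (simp add: mid_def e_def divide_simps)
      then show ?thesis using r(1)[of "Suc t"] that by (simp add: lo_def cS)
    qed
    have down: "r \<le> mid - e / 4" if "\<not> (g t (c t) \<longleftrightarrow> test_b t < test_a t)"
    proof -
      have "mid - e / 4 = (4 * real (c t) + 1) / (4 * 4 ^ t)"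
        by (simp add: mid_def e_def divide_simps)
      moreover have "c (Suc t) = 4 * c t" using that by (simp add: cS)
      ultimately show ?thesis using r(2)[of "Suc t"] by (simp add: hi_def add.commute)
    qed
    have "if g t (c t) then q * mid + Q / 4 \<le> q * r else q * r \<le> q * mid - Q / 4"
    proof (cases "q > 0")
      case True
      then show ?thesis
        using up down q0 mult_left_mono[of "mid + e / 4" r q] mult_left_mono[of r "mid - e / 4" q]
        by (auto simp: Q_def algebra_simps)
    next
      case False
      then show ?thesis
        using up down q0 mult_left_mono_neg[of "mid + e / 4" r q] mult_left_mono_neg[of r "mid - e / 4" q]
        by (auto simp: Q_def algebra_simps)
    qed
    moreover have "\<bar>rat_enum (d t) - \<delta>\<bar> \<le> Q / 8" using err' by (simp add: Q_def)
    ultimately have "if g t (c t) then \<delta> < rat_enum (test_k t) + q * r else rat_enum (test_k t) + q * r < \<delta>"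
      using g eq0 by (cases "g t (c t)"; simp; linarith)
    then have "\<delta> \<noteq> rat_enum (test_k t) + q * r \<and> (g t (c t) \<longleftrightarrow> \<delta> < rat_enum (test_k t) + q * r)"
      by (auto split: if_splits)
    then show ?thesis by (simp add: \<delta>_def bound_def q_def)
  qed
  have "computed_from fst [\<lambda>z. snd z] (\<lambda>z. d (snd z))"
    unfolding d_def test_defs
    by (rule computed_apply3[where h = "\<lambda>_. D", OF D] computed_intros | (rule computed_var, simp; fail))+
  note computed_d = computed_apply1[where h = "\<lambda>_. d", OF this]
  have "computed_from fst [\<lambda>z. fst (snd z), \<lambda>z. snd (snd z)] (\<lambda>z. of_bool (g (fst (snd z)) (snd (snd z))))"
    unfolding g_def below_mid_def test_defs Let_def
    by (rule computed_d computed_intros | (rule computed_var, simp; fail))+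
  note computed_g = computed_apply2[where h = "\<lambda>_ t r. of_bool (g t r)", OF this]
  have "computed_from fst [\<lambda>z. snd z] (\<lambda>z. c (snd z))"
    unfolding c_def test_defs
    by (rule computed_rec_nat) (rule computed_g computed_intros | (rule computed_var, simp; fail))+
  note computed_c = computed_apply1[where h = "\<lambda>_. c", OF this]
  have "computed_from fst [\<lambda>z. snd z] (\<lambda>z. of_bool (\<not> test_a (snd z) = test_b (snd z) \<and> g (snd z) (c (snd z))))"
    unfolding test_defs
    by (rule computed_g computed_c computed_intros | (rule computed_var, simp; fail))+
  moreover have "(\<not> test_a m = test_b m \<and> g m (c m)) \<longleftrightarrow> dist_below \<alpha> r m" for m
    using key by (auto simp: dist_below_def)
  ultimately have "computed_from fst [\<lambda>z. snd z] (\<lambda>z. of_bool (dist_below \<alpha> r (snd z)))" by simp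
  moreover have "1 \<le> r" "r \<le> 2" using r[of 0] by (simp_all add: lo_def hi_def c0)
  ultimately show ?thesis using that key by blast
qed

section \<open>Recursion over coded lists\<close>

text \<open>
  Lists grow at the head, so the suffixes of a list are its earlier states, and structural recursion
  on a list is primitive recursion along its suffixes, starting from the shortest one.
\<close>

lemma list_rec_nat:
  assumes "\<And>e \<tau>. F (e # \<tau>) = S e (list_encode \<tau>) (F \<tau>)"
  shows "F (list_decode l) = rec_nat (F []) (\<lambda>i v. S (code_hd (code_drop (code_length l - Suc i) l))
      (code_drop (code_length l - i) l) v) (code_length l)"
proof -
  define xs where "xs = list_decode l"
  have l: "l = list_encode xs" by (simp add: xs_def)
  have len: "code_length l = length xs" by (simp add: l code_length_def)
  have dr: "code_drop i l = list_encode (drop i xs)" for i by (simp add: l code_drop_def)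
  have "i \<le> length xs \<Longrightarrow> F (drop (length xs - i) xs) =
     rec_nat (F []) (\<lambda>i v. S (code_hd (code_drop (code_length l - Suc i) l))
      (code_drop (code_length l - i) l) v) i" for i
  proof (induction i)
    case (Suc i)
    have *: "drop (length xs - Suc i) xs = xs ! (length xs - Suc i) # drop (length xs - i) xs"
      using Suc.prems by (subst Cons_nth_drop_Suc[symmetric]) (auto simp: Suc_diff_Suc)
    have "code_hd (code_drop (code_length l - Suc i) l) = xs ! (length xs - Suc i)"
      unfolding len dr * by (simp add: code_hd_def)
    then show ?case using Suc by (simp add: * assms) (simp add: len dr)
  qed simp
  from this[of "length xs"] show ?thesis by (simp add: len xs_def)
qed

lemma computed_list_rec:
  assumes F: "\<And>x e \<tau>. F x (e # \<tau>) = S x e (list_encode \<tau>) (F x \<tau>)"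
    and S: "computed_from (\<lambda>z. orc (snd (snd (snd z))))
      (fst # (\<lambda>z. fst (snd z)) # (\<lambda>z. fst (snd (snd z))) # map (\<lambda>v z. v (snd (snd (snd z)))) vs)
      (\<lambda>z. S (snd (snd (snd z))) (fst z) (fst (snd z)) (fst (snd (snd z))))"
    and b: "computed_from orc vs (\<lambda>x. F x [])" and l: "computed_from orc vs l"
  shows "computed_from orc vs (\<lambda>x. F x (list_decode (l x)))"
proof -
  let ?vs = "fst # (\<lambda>z. fst (snd z)) # map (\<lambda>v z. v (snd (snd z))) vs"
  let ?orc = "\<lambda>z. orc (snd (snd z))"
  have up: "computed_from ?orc ?vs (\<lambda>z. f (snd (snd z)))" if "computed_from orc vs f" for f
    by (rule computed_trans[OF computed_reindex[OF that, of "\<lambda>z. snd (snd z)"]]) (auto intro: computed_var)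
  let ?e = "\<lambda>z. code_hd (code_drop (code_length (l (snd (snd z))) - Suc (fst z)) (l (snd (snd z))))"
  let ?t = "\<lambda>z. code_drop (code_length (l (snd (snd z))) - fst z) (l (snd (snd z)))"
  have e: "computed_from ?orc ?vs ?e" and t: "computed_from ?orc ?vs ?t"
    by (intro computed_intros up l computed_var; simp)+
  have r: "computed_from ?orc ?vs (\<lambda>z. fst (snd z))" by (rule computed_var) simp
  have "computed_from ?orc ?vs (\<lambda>z. S (snd (snd z)) (?e z) (?t z) (fst (snd z)))"
    by (rule computed_trans[OF computed_reindex[OF S, of "\<lambda>z. (?e z, ?t z, fst (snd z), snd (snd z))", simplified]])
      (use e t r up[OF computed_var] in auto)
  then have "computed_from orc vs (\<lambda>x. rec_nat (F x []) (\<lambda>i v. S x (code_hd (code_drop (code_length (l x) - Suc i) (l x)))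
      (code_drop (code_length (l x) - i) (l x)) v) (code_length (l x)))"
    by (intro computed_rec_nat b computed_intros l)
  moreover have "F x (list_decode (l x)) = rec_nat (F x []) (\<lambda>i v. S x (code_hd (code_drop (code_length (l x) - Suc i) (l x)))
      (code_drop (code_length (l x) - i) (l x)) v) (code_length (l x))" for x
    by (rule list_rec_nat) (rule F)
  ultimately show ?thesis by simp
qed

section \<open>The tree of regions\<close>

abbreviation "centre m \<equiv> pfst m"
abbreviation "witness m \<equiv> pfst (psnd m)"
abbreviation "level m \<equiv> psnd (psnd m)"

text \<open>
  From here on the radius is fixed. Balls of radius \<open>r / 2 ^ s\<close> around points
  \<open>\<alpha> c\<close> have a boundary that contains no point \<open>\<alpha> n\<close>, and
  membership of \<open>\<alpha> n\<close> in such a ball is decidable.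
\<close>

locale generic_radius =
  fixes \<alpha> :: "nat \<Rightarrow> 'a::{complete_space, perfect_space}" and r :: real
  assumes dense: "closure (range \<alpha>) = UNIV"
    and r: "1 \<le> r" "r \<le> 2"
    and avoids: "\<And>m. test_a m \<noteq> test_b m \<Longrightarrow> dist (\<alpha> (test_i m)) (\<alpha> (test_j m)) \<noteq> bound r m"
    and computed_dist_below: "computed_from fst [\<lambda>z. snd z] (\<lambda>z. of_bool (dist_below \<alpha> r (snd z)))"
begin

definition test :: "nat \<Rightarrow> nat \<Rightarrow> nat \<Rightarrow> nat \<Rightarrow> nat \<Rightarrow> nat \<Rightarrow> nat" where
  "test i j k a b y = prod_encode (i, prod_encode (j, prod_encode (k, prod_encode (a, prod_encode (b, y)))))"

lemma test_simps [simp]: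
  "test_i (test i j k a b y) = i" "test_j (test i j k a b y) = j" "test_k (test i j k a b y) = k"
  "test_a (test i j k a b y) = a" "test_b (test i j k a b y) = b" "test_y (test i j k a b y) = y"
  by (simp_all add: test_def test_defs)

lemma rat_enum_0 [simp]: "rat_enum 0 = 0"
  using pfst_le[of 0] psnd_le[of 0] by (simp add: rat_enum_eq)

lemma computed_test:
  assumes "computed_from orc vs i" "computed_from orc vs j" "computed_from orc vs k" "computed_from orc vs a" "computed_from orc vs b" "computed_from orc vs y"
  shows "computed_from orc vs (\<lambda>x. of_bool (dist_below \<alpha> r (test (i x) (j x) (k x) (a x) (b x) (y x))))"
  by (rule computed_apply1[where h = "\<lambda>_ m. of_bool (dist_below \<alpha> r m)", OF computed_dist_below])
    (unfold test_def, intro computed_intros assms)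

lemma ex_in_open: "open V \<Longrightarrow> V \<noteq> {} \<Longrightarrow> \<exists>n. \<alpha> n \<in> V"
proof -
  assume V: "open V" "V \<noteq> {}"
  then obtain x where "x \<in> V" by blast
  then have "x \<in> closure (range \<alpha>)" using dense by simp
  then have "range \<alpha> \<inter> V \<noteq> {}" using V \<open>x \<in> V\<close> by (metis open_Int_closure_eq_empty disjoint_iff inf_commute)
  then show ?thesis by auto
qed

lemma ex_small: "0 < e \<Longrightarrow> \<exists>N. \<forall>s\<ge>N. r / 2 ^ s < e"
proof -
  assume "0 < e"
  then obtain N where N: "(1/2::real) ^ N < e / 2" using real_arch_pow_inv[of "e/2" "1/2"] by auto
  have "r / 2 ^ s < e" if "s \<ge> N" for s
  proof -
    have "r / 2 ^ s \<le> 2 * (1/2) ^ s" using r(2) by (simp add: power_one_over field_simps)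
    also have "\<dots> \<le> 2 * (1/2) ^ N" using power_decreasing[OF that, of "1/2::real"] by simp
    finally show ?thesis using N by simp
  qed
  then show ?thesis by blast
qed

lemma r_pos: "0 < r / 2 ^ s" using r by simp

text \<open>
  Besides closeness itself, variants with a margin are used: a ball of radius \<open>r / 2 ^ t\<close>
  around \<open>\<alpha> i\<close> then lies inside (or outside) another ball. The condition
  \<open>s < t\<close> makes the coefficient of \<open>r\<close> nonzero, as required for
  decidability.
\<close>

definition close :: "nat \<Rightarrow> nat \<Rightarrow> nat \<Rightarrow> bool" where
  "close i j s \<longleftrightarrow> dist (\<alpha> i) (\<alpha> j) < r / 2 ^ s"

definition deep_close :: "nat \<Rightarrow> nat \<Rightarrow> nat \<Rightarrow> nat \<Rightarrow> bool" where
  "deep_close i j s t \<longleftrightarrow> s < t \<and> dist (\<alpha> i) (\<alpha> j) < r / 2 ^ s - r / 2 ^ t"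

definition nearly_close :: "nat \<Rightarrow> nat \<Rightarrow> nat \<Rightarrow> nat \<Rightarrow> bool" where
  "nearly_close i j s t \<longleftrightarrow> dist (\<alpha> i) (\<alpha> j) < r / 2 ^ s + r / 2 ^ t"

definition close_rat :: "nat \<Rightarrow> nat \<Rightarrow> nat \<Rightarrow> nat \<Rightarrow> bool" where
  "close_rat i j k y \<longleftrightarrow> dist (\<alpha> i) (\<alpha> j) < rat_enum k - r / 2 ^ y"

lemma close_test: "close i j s \<longleftrightarrow> dist_below \<alpha> r (test i j 0 1 0 s)"
  by (simp add: close_def dist_below_def bound_def)

lemma deep_close_test: "deep_close i j s t \<longleftrightarrow> s < t \<and> dist_below \<alpha> r (test i j 0 (2 ^ t) (2 ^ s) (s + t))"
proof -
  have "(2 ^ t - 2 ^ s) / 2 ^ (s + t) * r = r / 2 ^ s - r / 2 ^ t"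
    by (simp add: power_add field_simps)
  then show ?thesis
    by (auto simp: deep_close_def dist_below_def bound_def)
qed

lemma nearly_close_test:
  "nearly_close i j s t \<longleftrightarrow> dist_below \<alpha> r (test i j 0 (2 ^ s + 2 ^ t) 0 (s + t))"
proof -
  have "(2 ^ s + 2 ^ t) / 2 ^ (s + t) * r = r / 2 ^ s + r / 2 ^ t"
    by (simp add: power_add field_simps)
  then show ?thesis
    by (auto simp: nearly_close_def dist_below_def bound_def)
qed

lemma close_rat_test: "close_rat i j k y \<longleftrightarrow> dist_below \<alpha> r (test i j k 0 1 y)"
  by (simp add: close_rat_def dist_below_def bound_def)

lemma dist_neq: "dist (\<alpha> i) (\<alpha> j) \<noteq> r / 2 ^ s"
  using avoids[of "test i j 0 1 0 s"] by (simp add: bound_def)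

lemma dist_neq_add: "dist (\<alpha> i) (\<alpha> j) \<noteq> r / 2 ^ s + r / 2 ^ t"
proof -
  have "(2 ^ s + 2 ^ t) / 2 ^ (s + t) * r = r / 2 ^ s + r / 2 ^ t"
    by (simp add: power_add field_simps)
  then show ?thesis
    using avoids[of "test i j 0 (2 ^ s + 2 ^ t) 0 (s + t)"] by (simp add: bound_def)
qed

lemma computed_close [computed_intros]:
  "computed_from orc vs f \<Longrightarrow> computed_from orc vs g \<Longrightarrow> computed_from orc vs h \<Longrightarrow>
    computed_from orc vs (\<lambda>x. of_bool (close (f x) (g x) (h x)))"
  unfolding close_test by (intro computed_intros computed_test)

lemma computed_deep_close [computed_intros]:
  "computed_from orc vs f \<Longrightarrow> computed_from orc vs g \<Longrightarrow> computed_from orc vs h \<Longrightarrow> computed_from orc vs k \<Longrightarrow>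
    computed_from orc vs (\<lambda>x. of_bool (deep_close (f x) (g x) (h x) (k x)))"
  unfolding deep_close_test by (intro computed_intros computed_test)

lemma computed_nearly_close [computed_intros]:
  "computed_from orc vs f \<Longrightarrow> computed_from orc vs g \<Longrightarrow> computed_from orc vs h \<Longrightarrow> computed_from orc vs k \<Longrightarrow>
    computed_from orc vs (\<lambda>x. of_bool (nearly_close (f x) (g x) (h x) (k x)))"
  unfolding nearly_close_test by (intro computed_intros computed_test)

lemma computed_close_rat [computed_intros]:
  "computed_from orc vs f \<Longrightarrow> computed_from orc vs g \<Longrightarrow> computed_from orc vs h \<Longrightarrow> computed_from orc vs k \<Longrightarrow>
    computed_from orc vs (\<lambda>x. of_bool (close_rat (f x) (g x) (h x) (k x)))"
  unfolding close_rat_test by (intro computed_intros computed_test)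

text \<open>
  An entry \<open>\<langle>m, b\<rangle>\<close> restricts a point to a ball (\<open>b = 0\<close>) or
  to the complement of the closed ball. The sphere in between belongs to neither of the two; it is
  closed and, as it contains no \<open>\<alpha> n\<close>, nowhere dense.
\<close>

definition piece :: "nat \<Rightarrow> 'a set" where
  "piece e = (let c = \<alpha> (centre (pfst e)); \<rho> = r / 2 ^ level (pfst e) in
     if psnd e = 0 then {x. dist x c < \<rho>} else {x. \<rho> < dist x c})"

definition region :: "nat list \<Rightarrow> 'a set" where
  "region \<sigma> = (\<Inter>e\<in>set \<sigma>. piece e)"

lemma region_simps [simp]: "region [] = UNIV" "region (e # \<sigma>) = piece e \<inter> region \<sigma>"
  by (simp_all add: region_def)

lemma region_append [simp]: "region (\<rho> @ \<sigma>) = region \<rho> \<inter> region \<sigma>"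
  by (auto simp: region_def)

lemma open_piece: "open (piece e)"
  unfolding piece_def Let_def by (auto intro!: open_Collect_less continuous_intros)

lemma open_region: "open (region \<sigma>)"
  by (induction \<sigma>) (auto intro: open_piece)

lemma in_piece_iff:
  "\<alpha> n \<in> piece e \<longleftrightarrow> (psnd e = 0 \<longleftrightarrow> close n (centre (pfst e)) (level (pfst e)))"
  using dist_neq[of n "centre (pfst e)" "level (pfst e)"]
  by (auto simp: piece_def close_def Let_def)

lemma computed_in_region [computed_intros]:
  assumes "computed_from orc vs f" "computed_from orc vs l"
  shows "computed_from orc vs (\<lambda>x. of_bool (\<alpha> (f x) \<in> region (list_decode (l x))))"
proof (rule computed_apply2[OF _ assms, where h = "\<lambda>_ n l. of_bool (\<alpha> n \<in> region (list_decode l))"])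
  show "computed_from fst [\<lambda>z. fst (snd z), \<lambda>z. snd (snd z)]
      (\<lambda>z. of_bool (\<alpha> (fst (snd z)) \<in> region (list_decode (snd (snd z)))))"
    by (rule computed_list_rec[where F = "\<lambda>z \<sigma>. of_bool (\<alpha> (fst (snd z)) \<in> region \<sigma>)"
        and S = "\<lambda>z e t v. of_bool (psnd e = 0 \<longleftrightarrow> close (fst (snd z)) (centre (pfst e)) (level (pfst e))) * v"],
        simp add: in_piece_iff)
      (simp only: region_simps UNIV_I | rule computed_intros | (rule computed_var, simp; fail))+
qed

text \<open>
  At stage \<open>l = length \<sigma>\<close> the region is to be cut by a ball of level at least
  \<open>l\<close>. The witness \<open>\<alpha> (witness m)\<close> lies in the region and outside of
  the ball, so that both parts are nonempty. The centre is the point \<open>\<alpha> (pfst l)\<close>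
  whenever that point lies in the region; since each index is \<open>pfst l\<close> for infinitely
  many \<open>l\<close>, every \<open>\<alpha> c\<close> is the centre of cuts of arbitrarily high
  level.
\<close>

definition splits :: "nat list \<Rightarrow> nat \<Rightarrow> bool" where
  "splits \<sigma> m \<longleftrightarrow> \<alpha> (centre m) \<in> region \<sigma> \<and> \<alpha> (witness m) \<in> region \<sigma> \<and>
     \<not> close (witness m) (centre m) (level m) \<and> length \<sigma> \<le> level m \<and>
     (centre m = pfst (length \<sigma>) \<or> \<alpha> (pfst (length \<sigma>)) \<notin> region \<sigma>)"

text \<open>
  The states of the tree, newest entry first. The cut is the least possible one and hence a function
  of the earlier state, but minimality is checked by a bounded quantifier, so that validity is
  decidable without any search.
\<close>

fun valid :: "nat list \<Rightarrow> bool" where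
  "valid [] \<longleftrightarrow> True"
| "valid (e # \<sigma>) \<longleftrightarrow> valid \<sigma> \<and> splits \<sigma> (pfst e) \<and> (\<forall>m<pfst e. \<not> splits \<sigma> m) \<and> psnd e \<le> 1"

lemma computed_splits [computed_intros]:
  assumes "computed_from orc vs f" "computed_from orc vs l"
  shows "computed_from orc vs (\<lambda>x. of_bool (splits (list_decode (l x)) (f x)))"
  unfolding splits_def code_length_def[symmetric] by (intro computed_intros assms)

lemma computed_valid [computed_intros]:
  assumes "computed_from orc vs l"
  shows "computed_from orc vs (\<lambda>x. of_bool (valid (list_decode (l x))))"
proof (rule computed_apply1[OF _ assms, where h = "\<lambda>_ l. of_bool (valid (list_decode l))"])
  show "computed_from fst [\<lambda>z. snd z] (\<lambda>z. of_bool (valid (list_decode (snd z))))"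
    by (rule computed_list_rec[where F = "\<lambda>z \<sigma>. of_bool (valid \<sigma>)"
        and S = "\<lambda>z e t v. v * of_bool (splits (list_decode t) (pfst e) \<and>
          (\<forall>m<pfst e. \<not> splits (list_decode t) m) \<and> psnd e \<le> 1)"], simp)
      (simp only: valid.simps | rule computed_intros | (rule computed_var, simp; fail))+
qed

lemma valid_appendD: "valid (\<rho> @ \<sigma>) \<Longrightarrow> valid \<sigma>"
  by (induction \<rho>) auto

lemma ex_in_region: "valid \<sigma> \<Longrightarrow> \<exists>n. \<alpha> n \<in> region \<sigma>"
proof (cases \<sigma>)
  case (Cons e \<tau>)
  assume "valid \<sigma>"
  then have s: "splits \<tau> (pfst e)" using Cons by simp
  show ?thesis
  proof (cases "psnd e = 0")
    case True
    have "\<alpha> (centre (pfst e)) \<in> region \<sigma>"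
      using s True r_pos by (auto simp: Cons in_piece_iff splits_def close_def)
    then show ?thesis ..
  next
    case False
    have "\<alpha> (witness (pfst e)) \<in> region \<sigma>"
      using s False by (auto simp: Cons in_piece_iff splits_def)
    then show ?thesis ..
  qed
qed simp

text \<open>
  This is where perfectness enters: an open set around \<open>\<alpha> n\<close> contains a second
  point \<open>\<alpha> k\<close>, and small balls around \<open>\<alpha> n\<close> exclude it.
\<close>

lemma ex_splits:
  assumes "valid \<sigma>"
  shows "\<exists>m. splits \<sigma> m"
proof -
  obtain n where n: "\<alpha> n \<in> region \<sigma>" "n = pfst (length \<sigma>) \<or> \<alpha> (pfst (length \<sigma>)) \<notin> region \<sigma>"
    using ex_in_region[OF assms] by blast
  have "region \<sigma> - {\<alpha> n} \<noteq> {}"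
    using n(1) open_region[of \<sigma>] not_open_singleton[of "\<alpha> n"]
    by (metis Diff_eq_empty_iff empty_iff subset_singletonD)
  then obtain k where k: "\<alpha> k \<in> region \<sigma> - {\<alpha> n}"
    using ex_in_open[of "region \<sigma> - {\<alpha> n}"] open_region[of \<sigma>] by (auto intro: open_delete)
  then have "0 < dist (\<alpha> k) (\<alpha> n)" by simp
  then obtain N where N: "\<forall>s\<ge>N. r / 2 ^ s < dist (\<alpha> k) (\<alpha> n)" using ex_small by blast
  have "splits \<sigma> (prod_encode (n, prod_encode (k, max N (length \<sigma>))))"
    using n k N[rule_format, of "max N (length \<sigma>)"] by (auto simp: splits_def close_def)
  then show ?thesis ..
qed

definition next_split :: "nat list \<Rightarrow> nat" where "next_split \<sigma> = (LEAST m. splits \<sigma> m)"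

lemma valid_Cons_iff:
  "valid (e # \<sigma>) \<longleftrightarrow> valid \<sigma> \<and> pfst e = next_split \<sigma> \<and> psnd e \<le> 1"
proof (cases "valid \<sigma>")
  case True
  then obtain m where "splits \<sigma> m" using ex_splits by blast
  then have "splits \<sigma> (next_split \<sigma>)" unfolding next_split_def by (rule LeastI)
  moreover have "\<not> splits \<sigma> k" if "k < next_split \<sigma>" for k
    using not_less_Least[of k "splits \<sigma>"] that by (simp add: next_split_def)
  ultimately show ?thesis by auto (metis linorder_neqE_nat)
qed simp

text \<open>
  The two parts of a region are disjoint and the cut depends only on the state; hence a point has at
  most one state of each length, and all the states of a point are suffixes of each other.
\<close>

lemma valid_unique:
  assumes "length \<sigma> = length \<tau>" "valid \<sigma>" "valid \<tau>" "x \<in> region \<sigma>" "x \<in> region \<tau>"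
  shows "\<sigma> = \<tau>"
  using assms
proof (induction \<sigma> \<tau> rule: list_induct2)
  case (Cons e \<sigma> e' \<tau>)
  then have eq: "\<sigma> = \<tau>" unfolding valid_Cons_iff region_simps by blast
  then have "pfst e = pfst e'" "psnd e \<le> 1" "psnd e' \<le> 1" "x \<in> piece e" "x \<in> piece e'"
    using Cons.prems unfolding valid_Cons_iff region_simps by auto
  then have "psnd e = psnd e'" by (auto simp: piece_def Let_def split: if_splits)
  with \<open>pfst e = pfst e'\<close> have "e = e'" by (metis encode_pfst_psnd)
  with eq show ?case by simp
qed simp

lemma valid_comparable:
  assumes "length \<sigma> \<le> length \<tau>" "valid \<sigma>" "valid \<tau>" "x \<in> region \<sigma>" "x \<in> region \<tau>"
  shows "\<exists>\<rho>. \<tau> = \<rho> @ \<sigma>"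
proof -
  define i where "i = length \<tau> - length \<sigma>"
  have \<tau>: "\<tau> = take i \<tau> @ drop i \<tau>" by simp
  have "\<sigma> = drop i \<tau>"
  proof (rule valid_unique)
    show "length \<sigma> = length (drop i \<tau>)" using assms(1) by (simp add: i_def)
    show "valid (drop i \<tau>)" using assms(3) \<tau> valid_appendD by metis
    show "x \<in> region (drop i \<tau>)" using assms(5) \<tau> region_append by (metis IntD2)
  qed (fact assms)+
  then show ?thesis using \<tau> by metis
qed

text \<open>
  A point \<open>\<alpha> n\<close> lies on none of the spheres, so its branch of the tree never ends.
\<close>

lemma ex_valid_around:
  "\<exists>\<sigma>. valid \<sigma> \<and> length \<sigma> = l \<and> \<alpha> n \<in> region \<sigma>"
proof (induction l)
  case (Suc l)
  then obtain \<sigma> where \<sigma>: "valid \<sigma>" "length \<sigma> = l" "\<alpha> n \<in> region \<sigma>" by blast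
  define e where "e = prod_encode (next_split \<sigma>,
      of_bool (\<not> close n (centre (next_split \<sigma>)) (level (next_split \<sigma>))))"
  have "valid (e # \<sigma>)" "length (e # \<sigma>) = Suc l" "\<alpha> n \<in> region (e # \<sigma>)"
    using \<sigma> by (auto simp: valid_Cons_iff e_def in_piece_iff simp del: valid.simps)
  then show ?case by blast
qed simp

text \<open>
  The regions form a \<open>\<pi>\<close>-base: on the branch of \<open>\<alpha> c\<close> there are
  cuts by arbitrarily small balls with centre \<open>\<alpha> c\<close>, and the inner part of such a
  cut is contained in a given neighbourhood of \<open>\<alpha> c\<close>.
\<close>

lemma ex_region_subset:
  assumes "open V" "V \<noteq> {}"
  shows "\<exists>\<sigma>. valid \<sigma> \<and> region \<sigma> \<subseteq> V"
proof -
  obtain c where "\<alpha> c \<in> V" using ex_in_open assms by blast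
  then obtain d where d: "d > 0" "ball (\<alpha> c) d \<subseteq> V" using assms(1) open_contains_ball by blast
  obtain N where N: "\<forall>s\<ge>N. r / 2 ^ s < d" using ex_small d(1) by blast
  obtain \<sigma> where \<sigma>: "valid \<sigma>" "length \<sigma> = prod_encode (c, N)" "\<alpha> c \<in> region \<sigma>"
    using ex_valid_around by blast
  define e where "e = prod_encode (next_split \<sigma>, 0)"
  have v: "valid (e # \<sigma>)" by (simp add: valid_Cons_iff e_def \<sigma> del: valid.simps)
  then have "splits \<sigma> (next_split \<sigma>)" by (simp add: e_def)
  then have m: "centre (next_split \<sigma>) = c" "N \<le> level (next_split \<sigma>)"
    using \<sigma> le_prod_encode_2[of N c] by (auto simp: splits_def)
  have "region (e # \<sigma>) \<subseteq> ball (\<alpha> c) d"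
    using m N by (force simp: e_def piece_def Let_def dist_commute)
  with d v show ?thesis by blast
qed

subsection \<open>Balls inside regions\<close>

text \<open>
  A decidable condition which guarantees that the closed ball of radius \<open>r / 2 ^ s\<close>
  around \<open>\<alpha> k\<close> is contained in a piece, and which holds for all sufficiently good
  approximations \<open>\<alpha> k\<close> of a point of the piece.
\<close>

definition deep_in_piece :: "nat \<Rightarrow> nat \<Rightarrow> nat \<Rightarrow> bool" where
  "deep_in_piece k s e \<longleftrightarrow> (if psnd e = 0
     then deep_close k (centre (pfst e)) (level (pfst e)) s
     else \<not> nearly_close k (centre (pfst e)) (level (pfst e)) s)"

definition deep_in_region :: "nat \<Rightarrow> nat \<Rightarrow> nat list \<Rightarrow> bool" where
  "deep_in_region k s \<sigma> \<longleftrightarrow> (\<forall>e\<in>set \<sigma>. deep_in_piece k s e)"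

lemma deep_in_region_simps [simp]:
  "deep_in_region k s []"
  "deep_in_region k s (e # \<sigma>) \<longleftrightarrow> deep_in_piece k s e \<and> deep_in_region k s \<sigma>"
  by (auto simp: deep_in_region_def)

lemma computed_deep_in_region [computed_intros]:
  assumes "computed_from orc vs f" "computed_from orc vs g" "computed_from orc vs l"
  shows "computed_from orc vs (\<lambda>x. of_bool (deep_in_region (f x) (g x) (list_decode (l x))))"
proof (rule computed_apply3[OF _ assms, where h = "\<lambda>_ k s l. of_bool (deep_in_region k s (list_decode l))"])
  show "computed_from fst [\<lambda>z. fst (snd z), \<lambda>z. fst (snd (snd z)), \<lambda>z. snd (snd (snd z))]
      (\<lambda>z. of_bool (deep_in_region (fst (snd z)) (fst (snd (snd z))) (list_decode (snd (snd (snd z))))))"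
    by (rule computed_list_rec[where F = "\<lambda>z \<sigma>. of_bool (deep_in_region (fst (snd z)) (fst (snd (snd z))) \<sigma>)"
        and S = "\<lambda>z e t v. (if psnd e = 0
          then of_bool (deep_close (fst (snd z)) (centre (pfst e)) (level (pfst e)) (fst (snd (snd z))))
          else of_bool (\<not> nearly_close (fst (snd z)) (centre (pfst e)) (level (pfst e)) (fst (snd (snd z))))) * v"],
        simp add: deep_in_piece_def)
      (simp only: deep_in_region_simps | rule computed_intros | (rule computed_var, simp; fail))+
qed

lemma deep_in_piece_cball:
  assumes "deep_in_piece k s e" "dist (\<alpha> k) x \<le> r / 2 ^ s"
  shows "x \<in> piece e"
proof -
  let ?c = "centre (pfst e)"
  have "dist x (\<alpha> ?c) \<le> dist (\<alpha> k) x + dist (\<alpha> k) (\<alpha> ?c)"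
    "dist (\<alpha> k) (\<alpha> ?c) \<le> dist (\<alpha> k) x + dist x (\<alpha> ?c)"
    using dist_triangle dist_triangle3 by (metis dist_commute)+
  then show ?thesis
    using assms dist_neq_add[of k ?c "level (pfst e)" s]
    by (auto simp: deep_in_piece_def piece_def Let_def deep_close_def nearly_close_def
        split: if_splits)
qed

lemma deep_in_region_cball:
  "deep_in_region k s \<sigma> \<Longrightarrow> dist (\<alpha> k) x \<le> r / 2 ^ s \<Longrightarrow> x \<in> region \<sigma>"
  by (auto simp: deep_in_region_def region_def intro: deep_in_piece_cball)

lemma ex_deep_in_piece:
  assumes "x \<in> piece e"
  shows "\<exists>N. \<forall>s\<ge>N. \<forall>k. dist (\<alpha> k) x \<le> r / 2 ^ s \<longrightarrow> deep_in_piece k s e"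
proof -
  let ?c = "\<alpha> (centre (pfst e))" and ?R = "r / 2 ^ level (pfst e)"
  have "0 < \<bar>?R - dist x ?c\<bar> / 2"
    using assms by (auto simp: piece_def Let_def split: if_splits)
  then obtain N where N: "\<forall>s\<ge>N. r / 2 ^ s < \<bar>?R - dist x ?c\<bar> / 2" using ex_small by blast
  have "deep_in_piece k s e" if s: "s \<ge> max N (Suc (level (pfst e)))" "dist (\<alpha> k) x \<le> r / 2 ^ s" for s k
  proof -
    have "dist x ?c \<le> dist (\<alpha> k) x + dist (\<alpha> k) ?c" "dist (\<alpha> k) ?c \<le> dist (\<alpha> k) x + dist x ?c"
      using dist_triangle dist_triangle3 by (metis dist_commute)+
    moreover have "r / 2 ^ s < \<bar>?R - dist x ?c\<bar> / 2" using N s by simp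
    ultimately show ?thesis
      using assms s
      by (auto simp: deep_in_piece_def piece_def Let_def deep_close_def nearly_close_def split: if_splits)
  qed
  then show ?thesis by blast
qed

lemma ex_deep_in_region:
  "x \<in> region \<sigma> \<Longrightarrow> \<exists>N. \<forall>s\<ge>N. \<forall>k. dist (\<alpha> k) x \<le> r / 2 ^ s \<longrightarrow> deep_in_region k s \<sigma>"
proof (induction \<sigma>)
  case (Cons e \<sigma>)
  then obtain N M where "\<forall>s\<ge>N. \<forall>k. dist (\<alpha> k) x \<le> r / 2 ^ s \<longrightarrow> deep_in_region k s \<sigma>"
    "\<forall>s\<ge>M. \<forall>k. dist (\<alpha> k) x \<le> r / 2 ^ s \<longrightarrow> deep_in_piece k s e"
    using ex_deep_in_piece[of x e] by auto
  then show ?case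
    by (intro exI[of _ "max N M"]) (auto simp: deep_in_region_def)
qed (simp add: deep_in_region_def)

text \<open>
  A property that can be forced by extending an arbitrary state holds on a dense open set, and this
  set is the union of balls whose index set is as effective as the property.
\<close>

lemma dense_balls:
  assumes force: "\<And>\<sigma>. valid \<sigma> \<Longrightarrow> \<exists>\<rho>. valid (\<rho> @ \<sigma>) \<and> \<Gamma> (\<rho> @ \<sigma>)"
    and "open V" "V \<noteq> {}"
  shows "\<exists>\<sigma> k s. valid \<sigma> \<and> \<Gamma> \<sigma> \<and> deep_in_region k s \<sigma> \<and> \<alpha> k \<in> V"
proof -
  obtain \<sigma> where \<sigma>: "valid \<sigma>" "region \<sigma> \<subseteq> V" using ex_region_subset assms(2,3) by blast
  obtain \<rho> where \<rho>: "valid (\<rho> @ \<sigma>)" "\<Gamma> (\<rho> @ \<sigma>)" using force[OF \<sigma>(1)] by blast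
  obtain k where k: "\<alpha> k \<in> region (\<rho> @ \<sigma>)" using ex_in_region[OF \<rho>(1)] by blast
  obtain N where "\<forall>s\<ge>N. \<forall>n. dist (\<alpha> n) (\<alpha> k) \<le> r / 2 ^ s \<longrightarrow> deep_in_region n s (\<rho> @ \<sigma>)"
    using ex_deep_in_region[OF k] by blast
  then have "deep_in_region k N (\<rho> @ \<sigma>)" using r_pos[of N] by (simp add: less_imp_le)
  with \<rho> k \<sigma>(2) show ?thesis by auto
qed

section \<open>Walking\<close>

text \<open>
  A state is read as a sequence of instructions to walkers. Bit \<open>1\<close> means to wait; bit
  \<open>0\<close> at stage \<open>t\<close> means to move to \<open>\<alpha> (pfst t)\<close>. The
  walker \<open>n = \<langle>c, s\<rangle>\<close> starts at \<open>\<alpha> c\<close> and obeys only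
  if the step is so short that its whole path stays within \<open>r / 2 ^ s\<close> of
  \<open>\<alpha> c\<close> and its positions form a fast Cauchy sequence. The index of this sequence
  is the number of moves made so far, and a move that is refused counts as well.
\<close>

fun moves :: "nat list \<Rightarrow> nat" where
  "moves [] = 0"
| "moves (e # \<sigma>) = (if psnd e = 0 then Suc (moves \<sigma>) else moves \<sigma>)"

fun pos :: "nat \<Rightarrow> nat list \<Rightarrow> nat" where
  "pos n [] = pfst n"
| "pos n (e # \<sigma>) = (if psnd e = 0 \<and> close (pfst (length \<sigma>)) (pos n \<sigma>) (moves \<sigma> + psnd n + 2)
     then pfst (length \<sigma>) else pos n \<sigma>)"

lemma computed_moves [computed_intros]:
  assumes "computed_from orc vs l"
  shows "computed_from orc vs (\<lambda>x. moves (list_decode (l x)))"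
proof (rule computed_apply1[OF _ assms, where h = "\<lambda>_ l. moves (list_decode l)"])
  show "computed_from fst [\<lambda>z. snd z] (\<lambda>z. moves (list_decode (snd z)))"
    by (rule computed_list_rec[where F = "\<lambda>z \<sigma>. moves \<sigma>"
        and S = "\<lambda>z e t v. if psnd e = 0 then Suc v else v"], simp)
      (simp only: moves.simps | rule computed_intros | (rule computed_var, simp; fail))+
qed

lemma computed_pos [computed_intros]:
  assumes "computed_from orc vs f" "computed_from orc vs l"
  shows "computed_from orc vs (\<lambda>x. pos (f x) (list_decode (l x)))"
proof (rule computed_apply2[OF _ assms, where h = "\<lambda>_ n l. pos n (list_decode l)"])
  show "computed_from fst [\<lambda>z. fst (snd z), \<lambda>z. snd (snd z)] (\<lambda>z. pos (fst (snd z)) (list_decode (snd (snd z))))"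
    by (rule computed_list_rec[where F = "\<lambda>z \<sigma>. pos (fst (snd z)) \<sigma>"
        and S = "\<lambda>z e t v. if psnd e = 0 \<and>
            close (pfst (code_length t)) v (moves (list_decode t) + psnd (fst (snd z)) + 2)
          then pfst (code_length t) else v"], simp add: code_length_def)
      (simp only: pos.simps | rule computed_intros | (rule computed_var, simp; fail))+
qed

lemma pos_append_same_moves:
  "moves (\<rho> @ \<sigma>) = moves \<sigma> \<Longrightarrow> pos n (\<rho> @ \<sigma>) = pos n \<sigma>"
proof (induction \<rho>)
  case (Cons e \<rho>)
  have "moves \<sigma> \<le> moves (\<rho> @ \<sigma>)" by (induction \<rho>) auto
  with Cons show ?case by (auto split: if_splits)
qed simp

text \<open>
  The steps allowed after \<open>z\<close> moves have length at most
  \<open>r / 2 ^ (z + s + 2)\<close>, with \<open>s = psnd n\<close>; the bound is their geometric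
  sum.
\<close>

lemma dist_pos_append:
  "dist (\<alpha> (pos n (\<rho> @ \<sigma>))) (\<alpha> (pos n \<sigma>))
    \<le> r / 2 ^ (moves \<sigma> + psnd n + 1) - r / 2 ^ (moves (\<rho> @ \<sigma>) + psnd n + 1)"
proof (induction \<rho>)
  case (Cons e \<rho>)
  let ?p = "\<alpha> (pos n (\<rho> @ \<sigma>))" and ?q = "\<alpha> (pos n ((e # \<rho>) @ \<sigma>))" and ?z = "moves (\<rho> @ \<sigma>) + psnd n"
  show ?case
  proof (cases "psnd e = 0")
    case True
    have "dist ?q ?p \<le> r / 2 ^ (?z + 2)"
      using r_pos[of "?z + 2"] by (auto simp: close_def simp del: power_Suc)
    moreover have "r / 2 ^ (?z + 2) = r / 2 ^ (?z + 1) - r / 2 ^ (moves ((e # \<rho>) @ \<sigma>) + psnd n + 1)"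
      using True by (simp add: field_simps)
    ultimately show ?thesis
      using Cons dist_triangle[of ?q "\<alpha> (pos n \<sigma>)" ?p] by linarith
  next
    case False
    then show ?thesis using Cons by simp
  qed
qed simp

text \<open>
  All later positions of the walker, and their limit, lie in this ball.
\<close>

definition reach :: "nat \<Rightarrow> nat list \<Rightarrow> 'a set" where
  "reach n \<sigma> = ball (\<alpha> (pos n \<sigma>)) (r / 2 ^ (moves \<sigma> + psnd n))"

text \<open>
  Any point within the range of the next step can be made the permanent position of a walker: wait
  until a stage that proposes this point, move there, and repeat this, which only counts up the moves.
\<close>

lemma force_pos:
  assumes "valid \<sigma>" "close c (pos n \<sigma>) (moves \<sigma> + psnd n + 2)"
  shows "\<exists>\<rho>. valid (\<rho> @ \<sigma>) \<and> pos n (\<rho> @ \<sigma>) = c \<and> N \<le> moves (\<rho> @ \<sigma>)"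
proof -
  have ones: "\<exists>\<rho>. valid (\<rho> @ \<sigma>) \<and> length (\<rho> @ \<sigma>) = length \<sigma> + l \<and> pos n (\<rho> @ \<sigma>) = pos n \<sigma> \<and>
      moves (\<rho> @ \<sigma>) = moves \<sigma>" if "valid \<sigma>" for \<sigma> l
  proof (induction l)
    case 0
    then show ?case using that by (intro exI[of _ "[]"]) simp
  next
    case (Suc l)
    then obtain \<rho> where \<rho>: "valid (\<rho> @ \<sigma>)" "length (\<rho> @ \<sigma>) = length \<sigma> + l" "pos n (\<rho> @ \<sigma>) = pos n \<sigma>"
      "moves (\<rho> @ \<sigma>) = moves \<sigma>" by blast
    then show ?case
      by (intro exI[of _ "prod_encode (next_split (\<rho> @ \<sigma>), 1) # \<rho>"])
        (simp add: valid_Cons_iff del: valid.simps)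
  qed
  have one_move: "\<exists>\<rho>. valid (\<rho> @ \<sigma>) \<and> pos n (\<rho> @ \<sigma>) = c \<and> moves (\<rho> @ \<sigma>) = Suc (moves \<sigma>)"
    if \<sigma>: "valid \<sigma>" "close c (pos n \<sigma>) (moves \<sigma> + psnd n + 2)" for \<sigma>
  proof -
    \<comment> \<open>a stage not before the present one at which \<open>\<alpha> c\<close> is proposed\<close>
    define t where "t = prod_encode (c, length \<sigma>)"
    obtain \<rho> where \<rho>: "valid (\<rho> @ \<sigma>)" "length (\<rho> @ \<sigma>) = t" "pos n (\<rho> @ \<sigma>) = pos n \<sigma>"
      "moves (\<rho> @ \<sigma>) = moves \<sigma>"
      using ones[OF \<sigma>(1), of "t - length \<sigma>"] le_prod_encode_2[of "length \<sigma>" c] by (auto simp: t_def)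
    have "pfst (length \<rho> + length \<sigma>) = c" using \<rho>(2) by (simp add: t_def)
    with \<rho> \<sigma> show ?thesis
      by (intro exI[of _ "prod_encode (next_split (\<rho> @ \<sigma>), 0) # \<rho>"])
        (simp add: valid_Cons_iff del: valid.simps)
  qed
  show ?thesis
  proof (induction N)
    case 0
    then show ?case using one_move[OF assms] by blast
  next
    case (Suc N)
    then obtain \<rho> where \<rho>: "valid (\<rho> @ \<sigma>)" "pos n (\<rho> @ \<sigma>) = c" "N \<le> moves (\<rho> @ \<sigma>)" by blast
    have "close c (pos n (\<rho> @ \<sigma>)) (moves (\<rho> @ \<sigma>) + psnd n + 2)"
      using r by (simp add: \<rho> close_def)
    from one_move[OF \<rho>(1) this] obtain \<rho>' where "valid (\<rho>' @ \<rho> @ \<sigma>)" "pos n (\<rho>' @ \<rho> @ \<sigma>) = c"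
      "moves (\<rho>' @ \<rho> @ \<sigma>) = Suc (moves (\<rho> @ \<sigma>))" by blast
    then show ?case using \<rho>(3) by (intro exI[of _ "\<rho>' @ \<rho>"]) simp
  qed
qed

text \<open>
  If \<open>x\<close> has states with any number of moves, then reading off the positions gives names
  of the limits of all the walkers. It does not matter which state with a given number of moves is
  used, because states of \<open>x\<close> are comparable and waiting does not change positions.
\<close>

lemma generic_sequence:
  assumes name: "\<And>n j. \<exists>\<sigma>. valid \<sigma> \<and> x \<in> region \<sigma> \<and> moves \<sigma> = j \<and> q (prod_encode (n, j)) = pos n \<sigma>"
  shows "\<exists>T. seq_rep (cauchy_rep dist \<alpha>) q = Some T \<and>
    (\<forall>n \<sigma>. valid \<sigma> \<longrightarrow> x \<in> region \<sigma> \<longrightarrow> T n \<in> reach n \<sigma>)"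
proof -
  have qpos: "q (prod_encode (n, moves \<sigma>)) = pos n \<sigma>" if \<sigma>: "valid \<sigma>" "x \<in> region \<sigma>" for n \<sigma>
  proof -
    obtain \<tau> where \<tau>: "valid \<tau>" "x \<in> region \<tau>" "moves \<tau> = moves \<sigma>" "q (prod_encode (n, moves \<sigma>)) = pos n \<tau>"
      using name[where n = n and j = "moves \<sigma>"] by (elim exE conjE) (rule that)
    have "(\<exists>\<rho>. \<tau> = \<rho> @ \<sigma>) \<or> (\<exists>\<rho>. \<sigma> = \<rho> @ \<tau>)"
      using valid_comparable[OF _ \<sigma>(1) \<tau>(1) \<sigma>(2) \<tau>(2)] valid_comparable[OF _ \<tau>(1) \<sigma>(1) \<tau>(2) \<sigma>(2)]
      by (meson nat_le_linear)
    then have "pos n \<tau> = pos n \<sigma>"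
      using pos_append_same_moves[of _ \<sigma> n] pos_append_same_moves[of _ \<tau> n] \<tau>(3) by auto
    then show ?thesis using \<tau>(4) by simp
  qed
  have near: "dist (\<alpha> (q (prod_encode (n, j)))) (\<alpha> (pos n \<sigma>)) \<le> r / 2 ^ (moves \<sigma> + psnd n + 1) - r / 2 ^ (j + psnd n + 1)"
    if \<sigma>: "valid \<sigma>" "x \<in> region \<sigma>" "moves \<sigma> \<le> j" for n j \<sigma>
  proof -
    obtain \<tau> where \<tau>: "valid \<tau>" "x \<in> region \<tau>" "moves \<tau> = j" "q (prod_encode (n, j)) = pos n \<tau>"
      using name[where n = n and j = j] by (elim exE conjE) (rule that)
    consider \<rho> where "\<tau> = \<rho> @ \<sigma>" | \<rho> where "\<sigma> = \<rho> @ \<tau>"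
      using valid_comparable[OF _ \<sigma>(1) \<tau>(1) \<sigma>(2) \<tau>(2)] valid_comparable[OF _ \<tau>(1) \<sigma>(1) \<tau>(2) \<sigma>(2)]
      by (meson nat_le_linear)
    then show ?thesis
    proof cases
      case 1
      then show ?thesis using dist_pos_append[of n \<rho> \<sigma>] \<tau> by simp
    next
      case 2
      have "moves \<tau> \<le> moves (\<rho> @ \<tau>)" by (induction \<rho>) auto
      then have "moves \<sigma> = j" using 2 \<sigma>(3) \<tau>(3) by simp
      then show ?thesis using qpos[OF \<sigma>(1,2), of n] by simp
    qed
  qed
  have cauchy: "dist (\<alpha> (q (prod_encode (n, j)))) (\<alpha> (q (prod_encode (n, i)))) < (1/2) ^ i"
    if "i \<le> j" for n i j
  proof -
    obtain \<sigma> where \<sigma>: "valid \<sigma>" "x \<in> region \<sigma>" "moves \<sigma> = i" "q (prod_encode (n, i)) = pos n \<sigma>"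
      using name[where n = n and j = i] by (elim exE conjE) (rule that)
    have "dist (\<alpha> (q (prod_encode (n, j)))) (\<alpha> (pos n \<sigma>)) < r / 2 ^ (i + psnd n + 1)"
      using near[OF \<sigma>(1,2), of j n] \<sigma>(3) that r_pos[of "j + psnd n + 1"] by simp
    also have "\<dots> \<le> (1/2) ^ i"
    proof -
      have "r \<le> 2 * 2 ^ psnd n" using r(2) by (smt (verit) one_le_power)
      then show ?thesis by (simp add: power_add power_one_over field_simps)
    qed
    finally show ?thesis using \<sigma>(4) by simp
  qed
  have "\<exists>y. (\<lambda>j. dist (\<alpha> (q (prod_encode (n, j)))) y) \<longlonglongrightarrow> 0" for n
  proof -
    have "Cauchy (\<lambda>j. \<alpha> (q (prod_encode (n, j))))"
    proof (rule metric_CauchyI)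
      fix e :: real assume "e > 0"
      then obtain M where M: "(1/2::real) ^ M < e / 2" using real_arch_pow_inv[of "e/2" "1/2"] by auto
      have "dist (\<alpha> (q (prod_encode (n, i)))) (\<alpha> (q (prod_encode (n, j)))) < e" if "i \<ge> M" "j \<ge> M" for i j
        using cauchy[OF that(1), of n] cauchy[OF that(2), of n] M
          dist_triangle2[of "\<alpha> (q (prod_encode (n, i)))" "\<alpha> (q (prod_encode (n, j)))" "\<alpha> (q (prod_encode (n, M)))"]
        by linarith
      then show "\<exists>M. \<forall>m\<ge>M. \<forall>j\<ge>M. dist (\<alpha> (q (prod_encode (n, m)))) (\<alpha> (q (prod_encode (n, j)))) < e" by blast
    qed
    then obtain y where "(\<lambda>j. \<alpha> (q (prod_encode (n, j)))) \<longlonglongrightarrow> y"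
      using Cauchy_convergent_iff convergent_def by blast
    then show ?thesis by (intro exI[of _ y] iffD1[OF tendsto_dist_iff])
  qed
  then have some: "cauchy_rep dist \<alpha> (\<lambda>j. q (prod_encode (n, j))) \<noteq> None" for n
    unfolding cauchy_rep_def using cauchy[of _ _ n] by simp
  define T where "T = (\<lambda>n. the (cauchy_rep dist \<alpha> (\<lambda>j. q (prod_encode (n, j)))))"
  have T: "cauchy_rep dist \<alpha> (\<lambda>j. q (prod_encode (n, j))) = Some (T n)" for n
    using some by (simp add: T_def)
  have "seq_rep (cauchy_rep dist \<alpha>) q = Some T"
    using some by (simp add: seq_rep_def T_def)
  moreover have "T n \<in> reach n \<sigma>" if \<sigma>: "valid \<sigma>" "x \<in> region \<sigma>" for n \<sigma>
  proof -
    let ?q = "\<lambda>j. \<alpha> (q (prod_encode (n, j)))" and ?R = "r / 2 ^ (moves \<sigma> + psnd n + 1)"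
    have "(\<lambda>j. dist (?q j) (\<alpha> (pos n \<sigma>))) \<longlonglongrightarrow> dist (T n) (\<alpha> (pos n \<sigma>))"
      by (intro tendsto_intros cauchy_rep_dist(2)[OF T])
    moreover have "dist (?q j) (\<alpha> (pos n \<sigma>)) \<le> ?R" if "moves \<sigma> \<le> j" for j
      using near[OF \<sigma> that, of n] r_pos[of "j + psnd n + 1"] by simp
    ultimately have "dist (T n) (\<alpha> (pos n \<sigma>)) \<le> ?R"
      by (intro LIMSEQ_le_const2) auto
    also have "?R < r / 2 ^ (moves \<sigma> + psnd n)" using r by (simp add: field_simps)
    finally show ?thesis by (simp add: reach_def dist_commute)
  qed
  ultimately show ?thesis by blast
qed

end

section \<open>Type-2 computable maps\<close>

lemma computable_total:
  assumes "computed_from fst [\<lambda>z. snd z] (\<lambda>z. K (fst z) (snd z))"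
  shows "computable (\<lambda>p. Some (K p))"
proof -
  obtain t where "\<And>z. computes (fst z) t [snd z] (K (fst z) (snd z))"
    using assms unfolding computed_from_def by auto
  from this[of "(p, n)" for p n] show ?thesis
    unfolding computable_def by (intro exI[of _ t]) auto
qed

text \<open>
  The domain is restricted to the oracles for which all searches succeed.
\<close>

lemma computable_search:
  assumes A: "computed_from fst [\<lambda>z. fst (snd z), \<lambda>z. snd (snd z)] (\<lambda>z. of_bool (A (fst z) (fst (snd z)) (snd (snd z))))"
    and g: "computed_from fst [\<lambda>z. fst (snd z), \<lambda>z. snd (snd z)] (\<lambda>z. g (fst (snd z)) (snd (snd z)))"
  shows "computable (\<lambda>p. if \<forall>m. \<exists>w. A p w m then Some (\<lambda>m. g (LEAST w. A p w m) m) else None)"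
proof -
  obtain s where s: "\<And>z. computes (fst z) s [fst (snd z), snd (snd z)] (of_bool (\<not> A (fst z) (fst (snd z)) (snd (snd z))))"
    using computed_not[OF A] unfolding computed_from_def by auto
  obtain t where t: "\<And>z. computes (fst z) t [fst (snd z), snd (snd z)] (g (fst (snd z)) (snd (snd z)))"
    using g unfolding computed_from_def by auto
  have "computes p (Comp t [Mu s, Proj 0]) [m] (g (LEAST w. A p w m) m)" if ex: "\<forall>m. \<exists>w. A p w m" for p m
  proof (rule computes.comp)
    obtain k where k: "A p k m" using ex by blast
    have "computes p (Mu s) [m] (LEAST w. A p w m)"
    proof (rule computes_Least[where A = "\<lambda>w. A p w m"])
      show "computes p s [i, m] (of_bool (\<not> A p i m))" for i using s[of "(p, i, m)"] by simp
    qed (fact k)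
    then show "list_all2 (\<lambda>h y. computes p h [m] y) [Mu s, Proj 0] [LEAST w. A p w m, m]"
      using computes.proj[of 0 "[m]" p] by simp
    show "computes p t [LEAST w. A p w m, m] (g (LEAST w. A p w m) m)"
      using t[of "(p, LEAST w. A p w m, m)"] by simp
  qed
  then show ?thesis
    unfolding computable_def by (intro exI[of _ "Comp t [Mu s, Proj 0]"]) (auto split: if_splits)
qed

section \<open>Reducing to one point\<close>

lemma closure_disjoint_eq_UNIV:
  assumes "\<And>V. open V \<Longrightarrow> V \<noteq> {} \<Longrightarrow> V \<inter> G \<noteq> {}"
  shows "closure G = UNIV"
proof -
  have "- closure G = {}" using assms[of "- closure G"] closure_subset[of G] by blast
  then show ?thesis by blast
qed

context generic_radius
begin

lemma ex_moves_suffix: "j \<le> moves \<sigma> \<Longrightarrow> \<exists>\<rho> \<tau>. \<sigma> = \<rho> @ \<tau> \<and> moves \<tau> = j"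
proof (induction \<sigma>)
  case (Cons e \<sigma>)
  show ?case
  proof (cases "j \<le> moves \<sigma>")
    case True
    then show ?thesis using Cons.IH by (metis append_Cons)
  next
    case False
    then show ?thesis using Cons.prems by (intro exI[of _ "[]"] exI[of _ "e # \<sigma>"]) (auto split: if_splits)
  qed
qed simp

text \<open>
  The search of the output transformation: \<open>w\<close> consists of a state with the required
  number of moves and of a precision at which the name \<open>q\<close> shows that its point belongs
  to the region.
\<close>

definition locates :: "(nat \<Rightarrow> nat) \<Rightarrow> nat \<Rightarrow> nat \<Rightarrow> bool" where
  "locates q w m \<longleftrightarrow> valid (list_decode (pfst w)) \<and> moves (list_decode (pfst w)) = psnd m \<and>
     deep_in_region (q (psnd w)) (psnd w) (list_decode (pfst w))"

definition read_sequence :: "(nat \<Rightarrow> nat) \<rightharpoonup> (nat \<Rightarrow> nat)" where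
  "read_sequence q = (if \<forall>m. \<exists>w. locates q w m
     then Some (\<lambda>m. pos (pfst m) (list_decode (pfst (LEAST w. locates q w m)))) else None)"

lemma computable_read_sequence: "computable read_sequence"
  unfolding read_sequence_def[abs_def]
proof (rule computable_search)
  show "computed_from fst [\<lambda>z. fst (snd z), \<lambda>z. snd (snd z)] (\<lambda>z. of_bool (locates (fst z) (fst (snd z)) (snd (snd z))))"
    unfolding locates_def by (rule computed_intros | (rule computed_var, simp; fail))+
  show "computed_from fst [\<lambda>z. fst (snd z), \<lambda>z. snd (snd z)] (\<lambda>z. pos (pfst (snd (snd z))) (list_decode (pfst (fst (snd z)))))"
    by (rule computed_intros | (rule computed_var, simp; fail))+
qed

text \<open>
  The requirement with number \<open>j = \<langle>n, i\<rangle>\<close>: the walker \<open>n\<close>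
  has been confined to a ball disjoint from \<open>A i\<close>. The additional lower bound for the
  moves ensures that a point that meets all the requirements has states with any number of moves.
\<close>

definition escapes :: "(nat \<Rightarrow> 'a set) \<Rightarrow> nat \<Rightarrow> nat list \<Rightarrow> bool" where
  "escapes A j \<sigma> \<longleftrightarrow> valid \<sigma> \<and> j \<le> moves \<sigma> \<and> reach (pfst j) \<sigma> \<inter> A (psnd j) = {}"

text \<open>
  Density comes from the starting points: the limit of walker \<open>\<langle>c, s\<rangle>\<close> is
  within \<open>r / 2 ^ s\<close> of \<open>\<alpha> c\<close>.
\<close>

lemma read_sequence_correct:
  assumes x: "cauchy_rep dist \<alpha> q = Some x"
    and esc: "\<And>j. \<exists>\<sigma>. escapes A j \<sigma> \<and> x \<in> region \<sigma>"
  shows "\<exists>q' T. read_sequence q = Some q' \<and> seq_rep (cauchy_rep dist \<alpha>) q' = Some T \<and>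
    range T \<subseteq> - (\<Union>i. A i) \<and> closure (range T) = UNIV"
proof -
  have near: "dist (\<alpha> (q k)) x \<le> r / 2 ^ k" for k
  proof -
    have "(1/2) ^ k \<le> r / 2 ^ k" using r(1) by (simp add: power_one_over field_simps)
    then show ?thesis using cauchy_rep_dist(1)[OF x, of k] by linarith
  qed
  have "\<exists>w. locates q w m" for m
  proof -
    obtain \<sigma> where \<sigma>: "valid \<sigma>" "psnd m \<le> moves \<sigma>" "x \<in> region \<sigma>"
      using esc[of "psnd m"] by (auto simp: escapes_def)
    obtain \<rho> \<tau> where \<tau>: "\<sigma> = \<rho> @ \<tau>" "moves \<tau> = psnd m" using ex_moves_suffix[OF \<sigma>(2)] by blast
    then have v: "valid \<tau>" "x \<in> region \<tau>" using \<sigma> valid_appendD by auto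
    obtain N where "\<forall>s\<ge>N. \<forall>k. dist (\<alpha> k) x \<le> r / 2 ^ s \<longrightarrow> deep_in_region k s \<tau>"
      using ex_deep_in_region[OF v(2)] by blast
    then have "deep_in_region (q N) N \<tau>" using near by blast
    then have "locates q (prod_encode (list_encode \<tau>, N)) m" using v \<tau> by (simp add: locates_def)
    then show ?thesis ..
  qed
  then have all: "\<forall>m. \<exists>w. locates q w m" by blast
  define q' where "q' = (\<lambda>m. pos (pfst m) (list_decode (pfst (LEAST w. locates q w m))))"
  have q': "read_sequence q = Some q'" using all by (simp add: read_sequence_def q'_def)
  have "\<exists>\<sigma>. valid \<sigma> \<and> x \<in> region \<sigma> \<and> moves \<sigma> = j \<and> q' (prod_encode (n, j)) = pos n \<sigma>" for n j
  proof -
    define w where "w = (LEAST w. locates q w (prod_encode (n, j)))"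
    have "locates q w (prod_encode (n, j))" unfolding w_def by (rule LeastI_ex) (use all in blast)
    then show ?thesis
      using deep_in_region_cball[OF _ near]
      by (intro exI[of _ "list_decode (pfst w)"]) (auto simp: locates_def q'_def w_def)
  qed
  from generic_sequence[of x q', OF this] obtain T where T: "seq_rep (cauchy_rep dist \<alpha>) q' = Some T"
    "\<And>n \<sigma>. valid \<sigma> \<Longrightarrow> x \<in> region \<sigma> \<Longrightarrow> T n \<in> reach n \<sigma>" by blast
  have "T n \<notin> A i" for n i
  proof -
    obtain \<sigma> where "escapes A (prod_encode (n, i)) \<sigma>" "x \<in> region \<sigma>" using esc by blast
    then show ?thesis using T(2)[of \<sigma> n] by (auto simp: escapes_def)
  qed
  moreover have "closure (range T) = UNIV"
  proof (rule closure_disjoint_eq_UNIV)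
    fix V :: "'a set" assume V: "open V" "V \<noteq> {}"
    obtain c where "\<alpha> c \<in> V" using ex_in_open[OF V] by blast
    then obtain d where d: "d > 0" "ball (\<alpha> c) d \<subseteq> V" using V(1) open_contains_ball by blast
    obtain N where "\<forall>s\<ge>N. r / 2 ^ s < d" using ex_small d(1) by blast
    then have "T (prod_encode (c, N)) \<in> ball (\<alpha> c) d"
      using T(2)[of "[]" "prod_encode (c, N)"] by (force simp: reach_def)
    then show "V \<inter> range T \<noteq> {}" using d(2) by blast
  qed
  ultimately show ?thesis using q' T(1) by blast
qed

text \<open>
  The common part of both reductions. What remains for each representation \<open>\<psi>\<close> is to
  compute, from names of the sets \<open>A i\<close>, names of nowhere dense closed sets
  \<open>B j\<close> such that all points outside of \<open>B j\<close> meet requirement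
  \<open>j\<close>.
\<close>

theorem dbct_le_bct:
  assumes K: "computable (\<lambda>p. Some (K p))"
    and B: "\<And>p A. seq_rep \<psi> p = Some A \<Longrightarrow> \<forall>i. closed (A i) \<and> interior (A i) = {} \<Longrightarrow>
      \<exists>B. seq_rep \<psi> (K p) = Some B \<and> (\<forall>j. closed (B j) \<and> interior (B j) = {}) \<and>
        (\<forall>j x. x \<notin> B j \<longrightarrow> (\<exists>\<sigma>. escapes A j \<sigma> \<and> x \<in> region \<sigma>))"
  shows "\<lparr>in_rep = seq_rep \<psi>, out_rep = seq_rep (cauchy_rep dist \<alpha>), mvf = dbct_map\<rparr> \<le>\<^sub>s\<^sub>W
    \<lparr>in_rep = seq_rep \<psi>, out_rep = cauchy_rep dist \<alpha>, mvf = bct_map\<rparr>"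
  unfolding le_sW_def
proof (rule exI[of _ "\<lambda>p. Some (K p)"], rule exI[of _ read_sequence], intro conjI allI impI)
  show "computable (\<lambda>p. Some (K p))" by (fact K)
  show "computable read_sequence" by (fact computable_read_sequence)
  fix G assume G: "G \<turnstile> \<lparr>in_rep = seq_rep \<psi>, out_rep = cauchy_rep dist \<alpha>, mvf = bct_map\<rparr>"
  show "(read_sequence \<circ>\<^sub>m (G \<circ>\<^sub>m (\<lambda>p. Some (K p)))) \<turnstile>
    \<lparr>in_rep = seq_rep \<psi>, out_rep = seq_rep (cauchy_rep dist \<alpha>), mvf = dbct_map\<rparr>"
    unfolding realizes_def problem.select_convs
  proof (intro allI impI)
    fix p A Y assume A: "seq_rep \<psi> p = Some A" and Y: "dbct_map A = Some Y"
    have A': "\<forall>i. closed (A i) \<and> interior (A i) = {}"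
      and Y': "Y = {x. range x \<subseteq> - (\<Union>i. A i) \<and> - (\<Union>i. A i) \<subseteq> closure (range x)}"
      using Y unfolding dbct_map_def by (simp_all split: if_splits)
    obtain B where B': "seq_rep \<psi> (K p) = Some B" "\<forall>j. closed (B j) \<and> interior (B j) = {}"
      "\<And>j x. x \<notin> B j \<Longrightarrow> \<exists>\<sigma>. escapes A j \<sigma> \<and> x \<in> region \<sigma>"
      using B[OF A A'] by blast
    have "bct_map B = Some (- (\<Union>j. B j))" using B'(2) by (simp add: bct_map_def)
    then obtain q x where q: "G (K p) = Some q" "cauchy_rep dist \<alpha> q = Some x" "x \<notin> (\<Union>j. B j)"
      using G B'(1) unfolding realizes_def by force
    have "\<exists>\<sigma>. escapes A j \<sigma> \<and> x \<in> region \<sigma>" for j using B'(3) q(3) by blast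
    from read_sequence_correct[OF q(2) this] obtain q' T where "read_sequence q = Some q'"
      "seq_rep (cauchy_rep dist \<alpha>) q' = Some T" "range T \<subseteq> - (\<Union>i. A i)" "closure (range T) = UNIV"
      by blast
    then show "\<exists>q y. (read_sequence \<circ>\<^sub>m (G \<circ>\<^sub>m (\<lambda>p. Some (K p)))) p = Some q \<and>
        seq_rep (cauchy_rep dist \<alpha>) q = Some y \<and> y \<in> Y"
      using q(1) by (auto simp: map_comp_def Y')
  qed
qed

lemma ex_near_outside:
  assumes "closed A" "interior A = {}"
  shows "\<exists>c. close c k s \<and> \<alpha> c \<notin> A"
proof -
  have "closure (- A) = UNIV" using assms(2) by (simp add: closure_complement)
  then have "ball (\<alpha> k) (r / 2 ^ s) \<inter> - A \<noteq> {}"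
    using open_Int_closure_eq_empty[of "ball (\<alpha> k) (r / 2 ^ s)" "- A"] r_pos[of s] by auto
  then obtain c where "\<alpha> c \<in> ball (\<alpha> k) (r / 2 ^ s) \<inter> - A"
    using ex_in_open[of "ball (\<alpha> k) (r / 2 ^ s) \<inter> - A"] assms(1) by (auto simp: open_Compl open_Int)
  then show ?thesis by (auto simp: close_def dist_commute)
qed

section \<open>Negative information\<close>

text \<open>
  The entry \<open>v\<close> of the name of \<open>A i\<close> is a ball in the complement of
  \<open>A i\<close>; the test verifies that it contains the reach of walker \<open>n\<close>.
\<close>

definition negative_test :: "(nat \<Rightarrow> nat) \<Rightarrow> nat \<Rightarrow> nat list \<Rightarrow> nat \<Rightarrow> bool" where
  "negative_test p j \<sigma> v \<longleftrightarrow> j \<le> moves \<sigma> \<and>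
     close_rat (pos (pfst j) \<sigma>) (pfst (p (prod_encode (psnd j, v)))) (psnd (p (prod_encode (psnd j, v))))
       (moves \<sigma> + psnd (pfst j))"

text \<open>
  The complement of \<open>B j\<close> is the union of all balls that lie in regions of states for
  which requirement \<open>j\<close> has been verified. The radius \<open>1 / 2 ^ s\<close> is
  rational and at most \<open>r / 2 ^ s\<close>; the number \<open>0\<close> codes a ball of radius
  \<open>0\<close> and contributes nothing.
\<close>

definition negative_names :: "(nat \<Rightarrow> nat) \<Rightarrow> nat \<Rightarrow> nat" where
  "negative_names p x = (let j = pfst x; u = psnd x; l = pfst u; k = pfst (psnd u);
      s = pfst (psnd (psnd u)); v = psnd (psnd (psnd u)) in
    if valid (list_decode l) \<and> deep_in_region k s (list_decode l) \<and> negative_test p j (list_decode l) v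
    then prod_encode (k, prod_encode (prod_encode (1, 0), 2 ^ s - 1)) else 0)"

lemma computable_negative_names: "computable (\<lambda>p. Some (negative_names p))"
  by (rule computable_total)
    (unfold negative_names_def negative_test_def Let_def,
      (rule computed_intros | (rule computed_var, simp; fail))+)

lemma psi_minus_eq:
  "psi_minus \<alpha> p = Some (- (\<Union>i. ball (\<alpha> (pfst (p i))) (rat_enum (psnd (p i)))))"
  by (simp add: psi_minus_def pfst_def psnd_def case_prod_unfold)

lemma seq_rep_psi_minus:
  "seq_rep (psi_minus \<alpha>) p = Some (\<lambda>j. - (\<Union>i. ball (\<alpha> (pfst (p (prod_encode (j, i))))) (rat_enum (psnd (p (prod_encode (j, i)))))))"
  by (simp add: seq_rep_def psi_minus_eq)

text \<open>
  Send the walker to a point of one of the balls listed in the name of \<open>A i\<close> and let it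
  stay until its reach is contained in that ball.
\<close>

lemma negative_force:
  assumes A: "seq_rep (psi_minus \<alpha>) p = Some A" "interior (A (psnd j)) = {}" and \<sigma>: "valid \<sigma>"
  shows "\<exists>\<rho>. valid (\<rho> @ \<sigma>) \<and> (\<exists>v. negative_test p j (\<rho> @ \<sigma>) v)"
proof -
  let ?b = "\<lambda>v. p (prod_encode (psnd j, v))" and ?n = "pfst j"
  have A': "A (psnd j) = - (\<Union>v. ball (\<alpha> (pfst (?b v))) (rat_enum (psnd (?b v))))"
    using A(1) by (auto simp: seq_rep_psi_minus)
  then have "closed (A (psnd j))" by auto
  then obtain c where c: "close c (pos ?n \<sigma>) (moves \<sigma> + psnd ?n + 2)" "\<alpha> c \<notin> A (psnd j)"
    using ex_near_outside[OF _ A(2)] by blast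
  then obtain v where v: "dist (\<alpha> c) (\<alpha> (pfst (?b v))) < rat_enum (psnd (?b v))"
    by (auto simp: A' dist_commute)
  then obtain N where N: "\<forall>s\<ge>N. r / 2 ^ s < rat_enum (psnd (?b v)) - dist (\<alpha> c) (\<alpha> (pfst (?b v)))"
    using ex_small[of "rat_enum (psnd (?b v)) - dist (\<alpha> c) (\<alpha> (pfst (?b v)))"] by auto
  obtain \<rho> where \<rho>: "valid (\<rho> @ \<sigma>)" "pos ?n (\<rho> @ \<sigma>) = c" "max j N \<le> moves (\<rho> @ \<sigma>)"
    using force_pos[OF \<sigma> c(1)] by blast
  have "r / 2 ^ (moves (\<rho> @ \<sigma>) + psnd ?n) < rat_enum (psnd (?b v)) - dist (\<alpha> c) (\<alpha> (pfst (?b v)))"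
    using N \<rho>(3) by (intro N[rule_format]) simp
  then have "negative_test p j (\<rho> @ \<sigma>) v"
    using \<rho>(2,3) by (simp add: negative_test_def close_rat_def)
  then show ?thesis using \<rho>(1) by blast
qed

lemma negative_test_escapes:
  assumes A: "seq_rep (psi_minus \<alpha>) p = Some A" and "valid \<sigma>" "negative_test p j \<sigma> v"
  shows "escapes A j \<sigma>"
proof -
  let ?b = "p (prod_encode (psnd j, v))"
  have "reach (pfst j) \<sigma> \<subseteq> ball (\<alpha> (pfst ?b)) (rat_enum (psnd ?b))"
  proof
    fix y assume y: "y \<in> reach (pfst j) \<sigma>"
    have "dist (\<alpha> (pfst ?b)) y \<le> dist (\<alpha> (pos (pfst j) \<sigma>)) (\<alpha> (pfst ?b)) + dist (\<alpha> (pos (pfst j) \<sigma>)) y"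
      by (metis dist_commute dist_triangle)
    then show "y \<in> ball (\<alpha> (pfst ?b)) (rat_enum (psnd ?b))"
      using y assms(3) by (simp add: reach_def negative_test_def close_rat_def)
  qed
  then show ?thesis
    using A assms(2,3) by (auto simp: escapes_def negative_test_def seq_rep_psi_minus)
qed

lemma DBCT0_le_BCT0: "DBCT0 \<alpha> \<le>\<^sub>s\<^sub>W BCT0 \<alpha>"
  unfolding DBCT0_def BCT0_def
proof (rule dbct_le_bct[OF computable_negative_names])
  fix p A assume A: "seq_rep (psi_minus \<alpha>) p = Some A" "\<forall>i. closed (A i) \<and> interior (A i) = {}"
  define O' where "O' = (\<lambda>j i. let b = negative_names p (prod_encode (j, i)) in ball (\<alpha> (pfst b)) (rat_enum (psnd b)))"
  define B where "B = (\<lambda>j. - (\<Union>i. O' j i))"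
  have "seq_rep (psi_minus \<alpha>) (negative_names p) = Some B"
    by (simp add: seq_rep_psi_minus B_def O'_def Let_def)
  moreover have "closed (B j)" for j by (auto simp: B_def O'_def Let_def)
  moreover have "interior (B j) = {}" for j
  proof -
    have "closure (\<Union>i. O' j i) = UNIV"
    proof (rule closure_disjoint_eq_UNIV)
      fix V :: "'a set" assume V: "open V" "V \<noteq> {}"
      obtain \<sigma> k s v where *: "valid \<sigma>" "negative_test p j \<sigma> v" "deep_in_region k s \<sigma>" "\<alpha> k \<in> V"
        using dense_balls[of "\<lambda>\<sigma>. \<exists>v. negative_test p j \<sigma> v", OF negative_force[OF A(1)] V] A(2) by blast
      define i where "i = prod_encode (list_encode \<sigma>, prod_encode (k, prod_encode (s, v)))"
      have "\<alpha> k \<in> O' j i"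
        using * by (simp add: O'_def negative_names_def i_def rat_enum_eq)
      then show "V \<inter> (\<Union>i. O' j i) \<noteq> {}" using *(4) by blast
    qed
    then show ?thesis unfolding B_def by (simp only: interior_complement) simp
  qed
  moreover have "\<exists>\<sigma>. escapes A j \<sigma> \<and> x \<in> region \<sigma>" if xB: "x \<notin> B j" for j x
  proof -
    obtain i where i: "x \<in> O' j i" using xB by (auto simp: B_def)
    define l k s v where "l = pfst i" and "k = pfst (psnd i)" and "s = pfst (psnd (psnd i))"
      and "v = psnd (psnd (psnd i))"
    have ok: "valid (list_decode l) \<and> deep_in_region k s (list_decode l) \<and> negative_test p j (list_decode l) v"
    proof (rule ccontr)
      assume "\<not> ?thesis"
      then have "negative_names p (prod_encode (j, i)) = 0"
        by (auto simp: negative_names_def Let_def l_def k_def s_def v_def)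
      then show False using i psnd_le[of 0] by (simp add: O'_def)
    qed
    have "rat_enum (prod_encode (prod_encode (1, 0), 2 ^ s - 1)) = 1 / 2 ^ s"
      by (simp add: rat_enum_eq of_nat_diff)
    then have "dist (\<alpha> k) x < 1 / 2 ^ s"
      using i ok by (simp add: O'_def negative_names_def Let_def l_def k_def s_def v_def)
    also have "\<dots> \<le> r / 2 ^ s" using r(1) by (simp add: divide_right_mono)
    finally have "x \<in> region (list_decode l)" using ok by (blast intro: deep_in_region_cball less_imp_le)
    then show ?thesis using ok negative_test_escapes[OF A(1)] by blast
  qed
  ultimately show "\<exists>B. seq_rep (psi_minus \<alpha>) (negative_names p) = Some B \<and> (\<forall>j. closed (B j) \<and> interior (B j) = {}) \<and>
        (\<forall>j x. x \<notin> B j \<longrightarrow> (\<exists>\<sigma>. escapes A j \<sigma> \<and> x \<in> region \<sigma>))"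
    by (intro exI[of _ B]) simp
qed

end

section \<open>Positive information\<close>

lemma dist_infty_eq_0: "dist_infty a b = 0 \<longleftrightarrow> a = b"
  by (cases "(a, b)" rule: dist_infty.cases) auto

lemma cauchy_rep_infty_const:
  "cauchy_rep dist_infty (seq_infty \<alpha>) (\<lambda>_. c) = Some (seq_infty \<alpha> c)"
proof -
  have lim: "(\<lambda>_::nat. dist_infty (seq_infty \<alpha> c) x) \<longlonglongrightarrow> 0 \<longleftrightarrow> x = seq_infty \<alpha> c" for x
    using dist_infty_eq_0[of "seq_infty \<alpha> c" x] by (auto simp: LIMSEQ_const_iff)
  have "dist_infty (seq_infty \<alpha> c) (seq_infty \<alpha> c) = 0" by (simp add: dist_infty_eq_0)
  then show ?thesis unfolding cauchy_rep_def lim by simp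
qed

text \<open>
  The point \<open>\<infinity>\<close> has distance \<open>1\<close> from all other points, so the
  first entry of a name decides whether it names \<open>\<infinity>\<close>, and otherwise the whole
  name consists of indices of points of \<open>X\<close>.
\<close>

lemma cauchy_rep_infty_Some:
  assumes "cauchy_rep dist_infty (seq_infty \<alpha>) q = Some x"
  shows "(x = None \<and> (\<forall>n. q n = 0)) \<or>
    (\<exists>y. x = Some y \<and> (\<forall>n. q n \<noteq> 0 \<and> dist (\<alpha> (q n - 1)) y \<le> (1/2) ^ n))"
proof -
  have c: "\<And>k n. k \<le> n \<Longrightarrow> dist_infty (seq_infty \<alpha> (q n)) (seq_infty \<alpha> (q k)) < (1/2) ^ k"
    and e: "\<exists>x. (\<lambda>n. dist_infty (seq_infty \<alpha> (q n)) x) \<longlonglongrightarrow> 0"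
    and x: "x = (THE x. (\<lambda>n. dist_infty (seq_infty \<alpha> (q n)) x) \<longlonglongrightarrow> 0)"
    using assms by (auto simp: cauchy_rep_def split: if_splits)
  show ?thesis
  proof (cases "q 0")
    case 0
    have q: "q n = 0" for n
      using c[of 0 n] 0 by (cases "q n") auto
    then have "q = (\<lambda>_. 0)" by auto
    then show ?thesis using assms cauchy_rep_infty_const[of \<alpha> 0] by simp
  next
    case (Suc m)
    have q: "\<exists>m. q n = Suc m" for n
      using c[of 0 n] Suc by (cases "q n") auto
    define q' where "q' = (\<lambda>n. q n - 1)"
    have qq: "q n = Suc (q' n)" for n using q[of n] by (auto simp: q'_def)
    have lim: "(\<lambda>n. dist_infty (seq_infty \<alpha> (q n)) z) \<longlonglongrightarrow> 0 \<longleftrightarrow>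
        (\<exists>y. z = Some y \<and> (\<lambda>n. dist (\<alpha> (q' n)) y) \<longlonglongrightarrow> 0)" for z
      by (cases z) (auto simp: qq LIMSEQ_const_iff)
    obtain z where "(\<lambda>n. dist_infty (seq_infty \<alpha> (q n)) z) \<longlonglongrightarrow> 0" using e by (elim exE)
    then obtain y where y: "(\<lambda>n. dist (\<alpha> (q' n)) y) \<longlonglongrightarrow> 0" unfolding lim by (elim exE conjE)
    have uniq: "y' = y" if "(\<lambda>n. dist (\<alpha> (q' n)) y') \<longlonglongrightarrow> 0" for y'
      using LIMSEQ_unique[OF iffD2[OF tendsto_dist_iff that] iffD2[OF tendsto_dist_iff y]] .
    have "x = Some y"
      unfolding x
    proof (rule the_equality)
      show "(\<lambda>n. dist_infty (seq_infty \<alpha> (q n)) (Some y)) \<longlonglongrightarrow> 0" using y by (simp add: lim)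
      show "z = Some y" if "(\<lambda>n. dist_infty (seq_infty \<alpha> (q n)) z) \<longlonglongrightarrow> 0" for z
      proof -
        obtain y' where "z = Some y'" "(\<lambda>n. dist (\<alpha> (q' n)) y') \<longlonglongrightarrow> 0"
          using \<open>(\<lambda>n. dist_infty (seq_infty \<alpha> (q n)) z) \<longlonglongrightarrow> 0\<close> unfolding lim by (elim exE conjE)
        then show ?thesis using uniq by simp
      qed
    qed
    moreover have "cauchy_rep dist \<alpha> q' = Some y"
    proof -
      have "(THE y. (\<lambda>n. dist (\<alpha> (q' n)) y) \<longlonglongrightarrow> 0) = y" using y uniq by (rule the_equality)
      moreover have "\<forall>k. \<forall>n\<ge>k. dist (\<alpha> (q' n)) (\<alpha> (q' k)) < (1/2) ^ k" using c by (auto simp: qq)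
      ultimately show ?thesis using y by (auto simp: cauchy_rep_def)
    qed
    ultimately show ?thesis using cauchy_rep_dist(1)[of \<alpha> q' y] by (auto simp: qq)
  qed
qed

lemma open_Diff_finite_ne:
  fixes W :: "'a::{t1_space, perfect_space} set"
  assumes "finite F" "open W" "W \<noteq> {}"
  shows "W - F \<noteq> {}"
  using assms(1)
proof induction
  case (insert x F)
  have "open (W - F)" using assms(2) insert.hyps(1) by (auto intro: open_Diff finite_imp_closed)
  have "W - F \<noteq> {x}"
  proof
    assume "W - F = {x}"
    with \<open>open (W - F)\<close> have "open {x}" by simp
    then show False by (simp add: not_open_singleton)
  qed
  with insert.IH show ?case by blast
qed (use assms in simp)

context generic_radius
begin

text \<open>
  A number \<open>u = \<langle>l, k, s\<rangle>\<close> stands for the ball of radius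
  \<open>r / 2 ^ s\<close> around \<open>\<alpha> k\<close>. The point \<open>x\<close> is far if it
  is not in this ball shrunk by \<open>r / 2 ^ t\<close>.
\<close>

definition far :: "nat \<Rightarrow> nat \<Rightarrow> 'a \<Rightarrow> bool" where
  "far t u x \<longleftrightarrow> r / 2 ^ psnd (psnd u) - r / 2 ^ t \<le> dist x (\<alpha> (pfst (psnd u)))"

text \<open>
  Let \<open>G\<close> be a dense union of balls, those with \<open>ok u\<close>. The complement of
  \<open>G\<close> need not be given by positive information, but it has a nowhere dense closed
  superset that is. For each \<open>t = \<langle>c, s\<rangle>\<close> choose finitely many points
  that are far from the balls of \<open>G\<close> with numbers below \<open>t\<close>, at least one of
  them in the ball with radius \<open>r / 2 ^ s\<close> around \<open>\<alpha> c\<close> if possible.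
  Near a point outside of \<open>G\<close> such points exist for all small balls, so these points
  accumulate there. Near the centre of a ball of \<open>G\<close>, on the other hand, only finitely
  many of the chosen points remain, and finite sets have empty interior in a perfect space.
\<close>

lemma sparse_cover:
  fixes Y :: "nat \<Rightarrow> 'a set"
  assumes fin: "\<And>t. finite (Y t)"
    and Y_far: "\<And>t u y. y \<in> Y t \<Longrightarrow> u < t \<Longrightarrow> ok u \<Longrightarrow> far t u y"
    and hit: "\<And>t n. close n (pfst t) (psnd t) \<Longrightarrow> (\<And>u. u < t \<Longrightarrow> ok u \<Longrightarrow> far t u (\<alpha> n)) \<Longrightarrow>
      Y t \<inter> ball (\<alpha> (pfst t)) (r / 2 ^ psnd t) \<noteq> {}"
    and dn: "\<And>V. open V \<Longrightarrow> V \<noteq> {} \<Longrightarrow> \<exists>u. ok u \<and> \<alpha> (pfst (psnd u)) \<in> V"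
  shows "interior (closure (\<Union>t. Y t)) = {}"
    and "x \<notin> closure (\<Union>t. Y t) \<Longrightarrow> \<exists>u. ok u \<and> dist x (\<alpha> (pfst (psnd u))) < r / 2 ^ psnd (psnd u)"
proof -
  show "interior (closure (\<Union>t. Y t)) = {}"
  proof (rule ccontr)
    let ?V = "interior (closure (\<Union>t. Y t))"
    assume "?V \<noteq> {}"
    then obtain u where u: "ok u" "\<alpha> (pfst (psnd u)) \<in> ?V" using dn[of ?V] by auto
    define z \<rho> where "z = \<alpha> (pfst (psnd u))" and "\<rho> = r / 2 ^ psnd (psnd u)"
    have "0 < \<rho>" using r_pos by (simp only: \<rho>_def)
    then have "0 < \<rho> / 2" by simp
    then obtain N where N: "\<forall>s\<ge>N. r / 2 ^ s < \<rho> / 2" using ex_small by blast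
    define t0 where "t0 = max N (Suc u)"
    have t0: "r / 2 ^ t < \<rho> / 2" "u < t" if "t0 \<le> t" for t
      using that N by (auto simp: t0_def)
    \<comment> \<open>points chosen at stages from \<open>t0\<close> on avoid the ball of half the radius\<close>
    define W where "W = ?V \<inter> ball z (\<rho> / 2)"
    define F where "F = (\<Union>t<t0. Y t)"
    have "finite F" by (simp add: F_def fin)
    have W: "open W" "z \<in> W" using u(2) \<open>0 < \<rho> / 2\<close> by (auto simp: W_def z_def)
    have "W \<inter> (\<Union>t. Y t) \<subseteq> F"
    proof
      fix y assume y: "y \<in> W \<inter> (\<Union>t. Y t)"
      then obtain t where t: "y \<in> Y t" by blast
      show "y \<in> F"
      proof (cases "t < t0")
        case False
        then have "\<rho> / 2 < dist y z"
          using Y_far[OF t _ u(1)] t0[of t] by (simp add: far_def z_def \<rho>_def)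
        then show ?thesis using y by (simp add: W_def dist_commute)
      qed (use t in \<open>auto simp: F_def\<close>)
    qed
    moreover have "(W - F) \<inter> closure (\<Union>t. Y t) \<noteq> {}"
    proof -
      have "W \<subseteq> closure (\<Union>t. Y t)"
        unfolding W_def using interior_subset[of "closure (\<Union>t. Y t)"] by blast
      moreover have "W \<noteq> {}" using W(2) by blast
      then have "W - F \<noteq> {}" by (rule open_Diff_finite_ne[OF \<open>finite F\<close> W(1)])
      ultimately show ?thesis by blast
    qed
    moreover have "open (W - F)" using W(1) \<open>finite F\<close> by (auto intro: open_Diff finite_imp_closed)
    ultimately show False using open_Int_closure_eq_empty[of "W - F" "\<Union>t. Y t"] by blast
  qed
next
  assume x: "x \<notin> closure (\<Union>t. Y t)"
  show "\<exists>u. ok u \<and> dist x (\<alpha> (pfst (psnd u))) < r / 2 ^ psnd (psnd u)"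
  proof (rule ccontr)
    assume no: "\<not> ?thesis"
    have "open (- closure (\<Union>t. Y t))" by auto
    then obtain e where e: "e > 0" "ball x e \<subseteq> - closure (\<Union>t. Y t)"
      using x open_contains_ball by blast
    have "0 < e / 2" using e by simp
    then obtain s where s: "r / 2 ^ s < e / 2" using ex_small by blast
    obtain c where c: "\<alpha> c \<in> ball x (r / 2 ^ s)" using ex_in_open[of "ball x (r / 2 ^ s)"] r_pos[of s] by auto
    define t where "t = prod_encode (c, s)"
    obtain n where n: "\<alpha> n \<in> ball x (r / 2 ^ t) \<inter> ball (\<alpha> c) (r / 2 ^ s)"
      using ex_in_open[of "ball x (r / 2 ^ t) \<inter> ball (\<alpha> c) (r / 2 ^ s)"] c r_pos[of t]
      by (metis IntI centre_in_ball dist_commute empty_iff mem_ball open_Int open_ball)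
    have "Y t \<inter> ball (\<alpha> (pfst t)) (r / 2 ^ psnd t) \<noteq> {}"
    proof (rule hit)
      show "close n (pfst t) (psnd t)" using n by (simp add: t_def close_def dist_commute)
      fix u assume "u < t" "ok u"
      then have "r / 2 ^ psnd (psnd u) \<le> dist x (\<alpha> (pfst (psnd u)))" using no by force
      then show "far t u (\<alpha> n)"
        using n dist_triangle[of x "\<alpha> (pfst (psnd u))" "\<alpha> n"] by (simp add: far_def)
    qed
    then obtain y where y: "y \<in> Y t" "dist (\<alpha> c) y < r / 2 ^ s" by (auto simp: t_def)
    have "dist x (\<alpha> c) < r / 2 ^ s" using c by simp
    then have "dist x y < e" using y(2) s dist_triangle[of x y "\<alpha> c"] by linarith
    then have "y \<in> - closure (\<Union>t. Y t)" using e(2) by auto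
    then show False using y(1) closure_subset[of "\<Union>t. Y t"] by blast
  qed
qed

text \<open>
  Searches the first \<open>b\<close> entries of the name of \<open>A i\<close> for a proof that the
  reach of the walker meets \<open>A i\<close>. With positive information it is this failure of a
  requirement that can be verified.
\<close>

definition meets :: "(nat \<Rightarrow> nat) \<Rightarrow> nat \<Rightarrow> nat list \<Rightarrow> nat \<Rightarrow> bool" where
  "meets p j \<sigma> b \<longleftrightarrow> (\<exists>v<b. p (prod_encode (psnd j, v)) \<noteq> 0 \<and>
     deep_close (p (prod_encode (psnd j, v)) - 1) (pos (pfst j) \<sigma>) (moves \<sigma> + psnd (pfst j)) (psnd v))"

definition candidate :: "nat \<Rightarrow> nat \<Rightarrow> bool" where
  "candidate j u \<longleftrightarrow> valid (list_decode (pfst u)) \<and> j \<le> moves (list_decode (pfst u)) \<and>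
     deep_in_region (pfst (psnd u)) (psnd (psnd u)) (list_decode (pfst u))"

text \<open>
  The code \<open>w = \<langle>n, b\<rangle>\<close> consists of a candidate \<open>\<alpha> n\<close>
  for the point chosen at stage \<open>t\<close> and of a search bound. A ball \<open>u\<close> that
  contains \<open>\<alpha> n\<close> too deeply is ignored once the search shows that it does not
  belong to \<open>G\<close>.
\<close>

definition found :: "(nat \<Rightarrow> nat) \<Rightarrow> nat \<Rightarrow> nat \<Rightarrow> nat \<Rightarrow> bool" where
  "found p j t w \<longleftrightarrow> close (pfst w) (pfst t) (psnd t) \<and> (\<forall>u<t. candidate j u \<longrightarrow>
     \<not> deep_close (pfst w) (pfst (psnd u)) (psnd (psnd u)) t \<or> meets p j (list_decode (pfst u)) (psnd w))"

text \<open>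
  The first \<open>w\<close> that is found determines the point of stage \<open>t\<close>, which is
  output by its constant name; all other entries are constant names of \<open>\<infinity>\<close>.
\<close>

definition positive_names :: "(nat \<Rightarrow> nat) \<Rightarrow> nat \<Rightarrow> nat" where
  "positive_names p x = (let j = pfst x; t = pfst (pfst (psnd x)); w = psnd (pfst (psnd x)) in
    if found p j t w \<and> (\<forall>w'<w. \<not> found p j t w') then Suc (pfst w) else 0)"

lemma computed_found:
  assumes "computed_from orc vs f" "computed_from orc vs g" "computed_from orc vs h"
  shows "computed_from orc vs (\<lambda>x. of_bool (found (orc x) (f x) (g x) (h x)))"
proof (rule computed_apply3[OF _ assms, where h = "\<lambda>p j t w. of_bool (found p j t w)"])
  show "computed_from fst [\<lambda>z. fst (snd z), \<lambda>z. fst (snd (snd z)), \<lambda>z. snd (snd (snd z))]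
    (\<lambda>z. of_bool (found (fst z) (fst (snd z)) (fst (snd (snd z))) (snd (snd (snd z)))))"
    unfolding found_def candidate_def meets_def
    by (rule computed_intros | (rule computed_var, simp; fail))+
qed

lemma computable_positive_names: "computable (\<lambda>p. Some (positive_names p))"
proof (rule computable_total)
  show "computed_from fst [\<lambda>z. snd z] (\<lambda>z. positive_names (fst z) (snd z))"
    unfolding positive_names_def Let_def
    by (rule computed_found computed_intros | (rule computed_var, simp; fail))+
qed

text \<open>
  The reach is an open ball, so it meets the closure of the listed points iff it contains one of them,
  and this is visible from a sufficiently good approximation.
\<close>

lemma meets_iff:
  assumes "seq_rep (psi_plus \<alpha>) p = Some A"
  shows "(\<exists>b. meets p j \<sigma> b) \<longleftrightarrow> reach (pfst j) \<sigma> \<inter> A (psnd j) \<noteq> {}"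
proof -
  let ?i = "psnd j" and ?c = "pos (pfst j) \<sigma>" and ?y = "moves \<sigma> + psnd (pfst j)"
  define P where "P = (\<lambda>v. p (prod_encode (?i, v)))"
  have "psi_plus \<alpha> P = Some (A ?i)"
    using assms unfolding seq_rep_def P_def by (auto split: if_splits)
  then obtain X where X: "seq_rep (cauchy_rep dist_infty (seq_infty \<alpha>)) P = Some X"
    and Ai: "A ?i = closure {a. Some a \<in> range X}"
    unfolding psi_plus_def by auto
  have "cauchy_rep dist_infty (seq_infty \<alpha>) (\<lambda>l. P (prod_encode (u, l))) = Some (X u)" for u
    using X unfolding seq_rep_def by (auto split: if_splits)
  from cauchy_rep_infty_Some[OF this]
  have Xu: "(X u = None \<and> (\<forall>l. P (prod_encode (u, l)) = 0)) \<or>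
    (\<exists>y. X u = Some y \<and> (\<forall>l. P (prod_encode (u, l)) \<noteq> 0 \<and> dist (\<alpha> (P (prod_encode (u, l)) - 1)) y \<le> (1/2) ^ l))" for u .
  have "reach (pfst j) \<sigma> \<inter> A ?i \<noteq> {} \<longleftrightarrow> (\<exists>u a. X u = Some a \<and> a \<in> reach (pfst j) \<sigma>)"
  proof -
    have "open (reach (pfst j) \<sigma>)" by (simp add: reach_def)
    from open_Int_closure_eq_empty[OF this, of "{a. Some a \<in> range X}"]
    have "reach (pfst j) \<sigma> \<inter> A ?i \<noteq> {} \<longleftrightarrow> reach (pfst j) \<sigma> \<inter> {a. Some a \<in> range X} \<noteq> {}"
      unfolding Ai by simp
    also have "\<dots> \<longleftrightarrow> (\<exists>u a. X u = Some a \<and> a \<in> reach (pfst j) \<sigma>)"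
      unfolding image_def by (simp add: set_eq_iff) (metis)
    finally show ?thesis .
  qed
  also have "\<dots> \<longleftrightarrow> (\<exists>v. P v \<noteq> 0 \<and> deep_close (P v - 1) ?c ?y (psnd v))"
  proof (intro iffI; elim exE conjE)
    fix u a assume a: "X u = Some a" "a \<in> reach (pfst j) \<sigma>"
    have "0 < (r / 2 ^ ?y - dist (\<alpha> ?c) a) / 2" using a(2) by (simp add: reach_def)
    then obtain N where N: "\<forall>s\<ge>N. r / 2 ^ s < (r / 2 ^ ?y - dist (\<alpha> ?c) a) / 2" using ex_small by blast
    define l where "l = max N (Suc ?y)"
    have "(1/2) ^ l \<le> r / 2 ^ l" using r(1) by (simp add: power_one_over field_simps)
    moreover have "?y < l" by (simp add: l_def less_max_iff_disj)
    moreover have "P (prod_encode (u, l)) \<noteq> 0" "dist (\<alpha> (P (prod_encode (u, l)) - 1)) a \<le> (1/2) ^ l"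
      using Xu[of u] a(1) by auto
    moreover have "r / 2 ^ l < (r / 2 ^ ?y - dist (\<alpha> ?c) a) / 2" using N by (simp add: l_def)
    ultimately show "\<exists>v. P v \<noteq> 0 \<and> deep_close (P v - 1) ?c ?y (psnd v)"
      using dist_triangle2[of "\<alpha> (P (prod_encode (u, l)) - 1)" "\<alpha> ?c" a]
      by (intro exI[of _ "prod_encode (u, l)"]) (auto simp: deep_close_def)
  next
    fix v assume v: "P v \<noteq> 0" "deep_close (P v - 1) ?c ?y (psnd v)"
    obtain a where a: "X (pfst v) = Some a" "dist (\<alpha> (P v - 1)) a \<le> (1/2) ^ psnd v"
      using Xu[of "pfst v"] v(1) by (metis encode_pfst_psnd)
    have "(1/2) ^ psnd v \<le> r / 2 ^ psnd v" using r(1) by (simp add: power_one_over field_simps)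
    then have "a \<in> reach (pfst j) \<sigma>"
      using a(2) v(2) dist_triangle3[of "\<alpha> ?c" a "\<alpha> (P v - 1)"] by (simp add: deep_close_def reach_def)
    then show "\<exists>u a. X u = Some a \<and> a \<in> reach (pfst j) \<sigma>" using a(1) by blast
  qed
  also have "\<dots> \<longleftrightarrow> (\<exists>b. meets p j \<sigma> b)"
    unfolding meets_def P_def using lessI by blast
  finally show ?thesis by blast
qed

lemma positive_force:
  assumes A: "closed (A (psnd j))" "interior (A (psnd j)) = {}" and \<sigma>: "valid \<sigma>"
  shows "\<exists>\<rho>. valid (\<rho> @ \<sigma>) \<and> escapes A j (\<rho> @ \<sigma>)"
proof -
  let ?n = "pfst j"
  obtain c where c: "close c (pos ?n \<sigma>) (moves \<sigma> + psnd ?n + 2)" "\<alpha> c \<in> - A (psnd j)"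
    using ex_near_outside[OF A] by blast
  then obtain d where d: "d > 0" "ball (\<alpha> c) d \<subseteq> - A (psnd j)"
    using A(1) open_contains_ball by (metis open_Compl)
  obtain N where N: "\<forall>s\<ge>N. r / 2 ^ s < d" using ex_small d(1) by blast
  obtain \<rho> where \<rho>: "valid (\<rho> @ \<sigma>)" "pos ?n (\<rho> @ \<sigma>) = c" "max j N \<le> moves (\<rho> @ \<sigma>)"
    using force_pos[OF \<sigma> c(1)] by blast
  have "r / 2 ^ (moves (\<rho> @ \<sigma>) + psnd ?n) < d" using \<rho>(3) by (intro N[rule_format]) simp
  then have "reach ?n (\<rho> @ \<sigma>) \<subseteq> ball (\<alpha> c) d" using \<rho>(2) by (auto simp: reach_def)
  then show ?thesis using \<rho> d(2) by (auto simp: escapes_def)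
qed

lemma ex_uniform_bound:
  assumes "\<And>u. u < (t::nat) \<Longrightarrow> \<exists>b::nat. \<forall>b'\<ge>b. P u b'"
  shows "\<exists>b. \<forall>u<t. P u b"
proof -
  obtain f where f: "\<And>u b'. u < t \<Longrightarrow> f u \<le> b' \<Longrightarrow> P u b'" using assms by metis
  have "f u \<le> Max (f ` {..<t})" if "u < t" for u using that by simp
  then show ?thesis using f by blast
qed

text \<open>
  The balls of \<open>G\<close> are those which are deep in the region of a state that satisfies
  requirement \<open>j\<close>. Whether the reach meets \<open>A i\<close> is only semidecidable, but
  stage \<open>t\<close> involves finitely many balls, so that one search bound serves for all of
  them.
\<close>

lemma DBCT2_le_BCT2: "DBCT2 \<alpha> \<le>\<^sub>s\<^sub>W BCT2 \<alpha>"
  unfolding DBCT2_def BCT2_def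
proof (rule dbct_le_bct[OF computable_positive_names])
  fix p A assume A: "seq_rep (psi_plus \<alpha>) p = Some A" "\<forall>i. closed (A i) \<and> interior (A i) = {}"
  define Y where "Y = (\<lambda>j t. {\<alpha> (pfst w) |w. found p j t w \<and> (\<forall>w'<w. \<not> found p j t w')})"
  define B where "B = (\<lambda>j. closure (\<Union>t. Y j t))"
  define ok where "ok = (\<lambda>j u. candidate j u \<and> escapes A j (list_decode (pfst u)))"
  have "psi_plus \<alpha> (\<lambda>y. positive_names p (prod_encode (j, y))) = Some (B j)" for j
  proof -
    define X where "X = (\<lambda>i. seq_infty \<alpha> (positive_names p (prod_encode (j, prod_encode (i, 0)))))"
    have "(\<lambda>l. positive_names p (prod_encode (j, prod_encode (i, l)))) =
        (\<lambda>_. positive_names p (prod_encode (j, prod_encode (i, 0))))" for i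
      by (simp add: positive_names_def)
    then have "cauchy_rep dist_infty (seq_infty \<alpha>) (\<lambda>l. positive_names p (prod_encode (j, prod_encode (i, l)))) = Some (X i)" for i
      unfolding X_def by (metis cauchy_rep_infty_const)
    then have "seq_rep (cauchy_rep dist_infty (seq_infty \<alpha>)) (\<lambda>y. positive_names p (prod_encode (j, y))) = Some X"
      by (simp add: seq_rep_def)
    moreover have "{a. Some a \<in> range X} = (\<Union>t. Y j t)"
    proof (intro set_eqI iffI)
      fix a assume "a \<in> {a. Some a \<in> range X}"
      then obtain i where i: "X i = Some a" by auto
      let ?w = "psnd i" and ?t = "pfst i"
      have *: "found p j ?t ?w \<and> (\<forall>w'<?w. \<not> found p j ?t w')"
        using i by (auto simp: X_def positive_names_def Let_def split: if_splits)
      then have "a = \<alpha> (pfst ?w)" using i by (simp add: X_def positive_names_def)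
      then show "a \<in> (\<Union>t. Y j t)" using * unfolding Y_def by blast
    next
      fix a assume "a \<in> (\<Union>t. Y j t)"
      then obtain t w where "a = \<alpha> (pfst w)" "found p j t w" "\<forall>w'<w. \<not> found p j t w'"
        unfolding Y_def by blast
      then have "X (prod_encode (t, w)) = Some a" by (simp add: X_def positive_names_def)
      then show "a \<in> {a. Some a \<in> range X}" by (metis mem_Collect_eq rangeI)
    qed
    ultimately show ?thesis by (simp add: psi_plus_def B_def)
  qed
  then have "seq_rep (psi_plus \<alpha>) (positive_names p) = Some B"
    by (simp add: seq_rep_def)
  moreover have cover: "interior (B j) = {}"
    "x \<notin> B j \<Longrightarrow> \<exists>u. ok j u \<and> dist x (\<alpha> (pfst (psnd u))) < r / 2 ^ psnd (psnd u)" for j x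
  proof -
    have uniq: "w = w'" if "found p j t w" "\<forall>v<w. \<not> found p j t v" "found p j t w'" "\<forall>v<w'. \<not> found p j t v" for t w w'
      using that linorder_neqE_nat by blast
    have fin: "finite (Y j t)" for t
    proof (cases "\<exists>w. found p j t w \<and> (\<forall>w'<w. \<not> found p j t w')")
      case True
      then obtain w where "found p j t w" "\<forall>w'<w. \<not> found p j t w'" by blast
      then have "Y j t \<subseteq> {\<alpha> (pfst w)}" unfolding Y_def using uniq by blast
      then show ?thesis using finite_subset by blast
    next
      case False
      then have "Y j t = {}" unfolding Y_def by blast
      then show ?thesis by simp
    qed
    have level: "psnd (psnd u) < t" if "u < t" for u t
      using psnd_le[of u] psnd_le[of "psnd u"] that by linarith
    have Y_far: "far t u y" if y: "y \<in> Y j t" and u: "u < t" "ok j u" for t u y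
    proof -
      obtain w where w: "y = \<alpha> (pfst w)" "found p j t w" using y unfolding Y_def by blast
      have "\<not> meets p j (list_decode (pfst u)) b" for b
        using u(2) meets_iff[OF A(1), of j "list_decode (pfst u)"] by (auto simp: ok_def escapes_def)
      then have "\<not> deep_close (pfst w) (pfst (psnd u)) (psnd (psnd u)) t"
        using w(2) u by (auto simp: found_def ok_def)
      then show ?thesis using level[OF u(1)] by (simp add: far_def deep_close_def w(1) not_less)
    qed
    have hit: "Y j t \<inter> ball (\<alpha> (pfst t)) (r / 2 ^ psnd t) \<noteq> {}"
      if n: "close n (pfst t) (psnd t)" "\<And>u. u < t \<Longrightarrow> ok j u \<Longrightarrow> far t u (\<alpha> n)" for t n
    proof -
      have "\<exists>b. \<forall>u<t. candidate j u \<longrightarrow> \<not> deep_close n (pfst (psnd u)) (psnd (psnd u)) t \<or>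
          meets p j (list_decode (pfst u)) b"
      proof (rule ex_uniform_bound)
        fix u assume u: "u < t"
        show "\<exists>b. \<forall>b'\<ge>b. candidate j u \<longrightarrow> \<not> deep_close n (pfst (psnd u)) (psnd (psnd u)) t \<or>
          meets p j (list_decode (pfst u)) b'"
        proof (cases "candidate j u \<and> \<not> ok j u")
          case True
          then have "reach (pfst j) (list_decode (pfst u)) \<inter> A (psnd j) \<noteq> {}"
            by (auto simp: ok_def candidate_def escapes_def)
          then obtain b where "meets p j (list_decode (pfst u)) b" using meets_iff[OF A(1)] by blast
          then have "meets p j (list_decode (pfst u)) b'" if "b \<le> b'" for b'
            using that unfolding meets_def by (meson less_le_trans)
          then show ?thesis by blast
        next
          case False
          then have "candidate j u \<Longrightarrow> \<not> deep_close n (pfst (psnd u)) (psnd (psnd u)) t"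
            using n(2)[OF u] by (auto simp: far_def deep_close_def)
          then show ?thesis by blast
        qed
      qed
      then obtain b where "found p j t (prod_encode (n, b))" using n(1) by (auto simp: found_def)
      then have ex: "\<exists>w. found p j t w" by blast
      define w where "w = (LEAST w. found p j t w)"
      have "found p j t w" unfolding w_def using ex by (rule LeastI_ex)
      moreover have "\<forall>w'<w. \<not> found p j t w'" unfolding w_def using not_less_Least by blast
      ultimately have "\<alpha> (pfst w) \<in> Y j t" "close (pfst w) (pfst t) (psnd t)"
        unfolding Y_def found_def by blast+
      then show ?thesis by (auto simp: close_def dist_commute)
    qed
    have dn: "\<exists>u. ok j u \<and> \<alpha> (pfst (psnd u)) \<in> V" if V: "open V" "V \<noteq> {}" for V
    proof -
      obtain \<sigma> k s where *: "valid \<sigma>" "escapes A j \<sigma>" "deep_in_region k s \<sigma>" "\<alpha> k \<in> V"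
        using dense_balls[of "escapes A j", OF positive_force V] A(2) by blast
      then show ?thesis
        by (intro exI[of _ "prod_encode (list_encode \<sigma>, prod_encode (k, s))"])
          (auto simp: ok_def candidate_def escapes_def)
    qed
    show "interior (B j) = {}"
      unfolding B_def by (rule sparse_cover(1)[of "Y j" "ok j"]) (fact fin Y_far hit dn)+
    show "\<exists>u. ok j u \<and> dist x (\<alpha> (pfst (psnd u))) < r / 2 ^ psnd (psnd u)" if "x \<notin> B j"
      using that unfolding B_def by (rule sparse_cover(2)[of "Y j" "ok j", rotated -1]) (fact fin Y_far hit dn)+
  qed
  moreover have "\<exists>\<sigma>. escapes A j \<sigma> \<and> x \<in> region \<sigma>" if x: "x \<notin> B j" for j x
  proof -
    obtain u where u: "ok j u" "dist x (\<alpha> (pfst (psnd u))) < r / 2 ^ psnd (psnd u)" using cover(2)[OF x] by blast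
    have "x \<in> region (list_decode (pfst u))"
      using u by (intro deep_in_region_cball[of "pfst (psnd u)" "psnd (psnd u)"])
        (auto simp: ok_def candidate_def dist_commute)
    then show ?thesis using u(1) by (auto simp: ok_def)
  qed
  moreover have "closed (B j)" for j by (simp add: B_def)
  ultimately show "\<exists>B. seq_rep (psi_plus \<alpha>) (positive_names p) = Some B \<and> (\<forall>j. closed (B j) \<and> interior (B j) = {}) \<and>
        (\<forall>j x. x \<notin> B j \<longrightarrow> (\<exists>\<sigma>. escapes A j \<sigma> \<and> x \<in> region \<sigma>))"
    by (intro exI[of _ B]) simp
qed

end

section \<open>The equivalence\<close>

text \<open>
  The first point of a sequence in \<open>X - (\<Union>i. A i)\<close> is a solution.
\<close>

lemma bct_le_dbct:
  fixes \<alpha> :: "nat \<Rightarrow> 'a::metric_space"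
  shows "\<lparr>in_rep = \<psi>, out_rep = cauchy_rep dist \<alpha>, mvf = bct_map\<rparr> \<le>\<^sub>s\<^sub>W
    \<lparr>in_rep = \<psi>, out_rep = seq_rep (cauchy_rep dist \<alpha>), mvf = dbct_map\<rparr>"
  unfolding le_sW_def
proof (rule exI[of _ Some], rule exI[of _ "\<lambda>q. Some (\<lambda>l. q (prod_encode (0, l)))"], intro conjI allI impI)
  have "computable (\<lambda>p. Some (\<lambda>n. p n))"
    by (rule computable_total) (rule computed_intros | (rule computed_var, simp; fail))+
  then show "computable Some" by simp
  show "computable (\<lambda>q. Some (\<lambda>l. q (prod_encode (0, l))))"
    by (rule computable_total) (rule computed_intros | (rule computed_var, simp; fail))+
  fix G assume G: "G \<turnstile> \<lparr>in_rep = \<psi>, out_rep = seq_rep (cauchy_rep dist \<alpha>), mvf = dbct_map\<rparr>"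
  show "((\<lambda>q. Some (\<lambda>l. q (prod_encode (0, l)))) \<circ>\<^sub>m (G \<circ>\<^sub>m Some)) \<turnstile>
      \<lparr>in_rep = \<psi>, out_rep = cauchy_rep dist \<alpha>, mvf = bct_map\<rparr>"
    unfolding realizes_def problem.select_convs
  proof (intro allI impI)
    fix p A Y assume A: "\<psi> p = Some A" and Y: "bct_map A = Some Y"
    have nd: "\<forall>i. closed (A i) \<and> interior (A i) = {}" and Y': "Y = - (\<Union>i. A i)"
      using Y unfolding bct_map_def by (simp_all split: if_splits)
    then obtain q T where q: "G p = Some q" "seq_rep (cauchy_rep dist \<alpha>) q = Some T" "range T \<subseteq> - (\<Union>i. A i)"
      using G A unfolding realizes_def by (force simp: dbct_map_def)
    have "cauchy_rep dist \<alpha> (\<lambda>l. q (prod_encode (0, l))) = Some (T 0)"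
      using q(2) unfolding seq_rep_def by (auto split: if_splits)
    moreover have "T 0 \<in> Y" using q(3) Y' by blast
    ultimately show "\<exists>q y. ((\<lambda>q. Some (\<lambda>l. q (prod_encode (0, l)))) \<circ>\<^sub>m (G \<circ>\<^sub>m Some)) p = Some q \<and>
        cauchy_rep dist \<alpha> q = Some y \<and> y \<in> Y"
      using q(1) by (auto simp: map_comp_def)
  qed
qed

theorem corollary7p4:
  fixes \<alpha> :: "nat \<Rightarrow> 'a::{complete_space, perfect_space}"
  assumes "computable_polish \<alpha>"
  shows "DBCT0 \<alpha> \<equiv>\<^sub>s\<^sub>W BCT0 \<alpha> \<and> DBCT2 \<alpha> \<equiv>\<^sub>s\<^sub>W BCT2 \<alpha>"
proof -
  obtain r where "1 \<le> r" "r \<le> 2"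
    "\<And>m. test_a m \<noteq> test_b m \<Longrightarrow> dist (\<alpha> (test_i m)) (\<alpha> (test_j m)) \<noteq> bound r m"
    "computed_from fst [\<lambda>z. snd z] (\<lambda>z. of_bool (dist_below \<alpha> r (snd z)))"
    using ex_generic_radius[OF assms] by blast
  then interpret generic_radius \<alpha> r
    using assms by unfold_locales (auto simp: computable_polish_def)
  show ?thesis
    unfolding equiv_sW_def
  proof (intro conjI DBCT0_le_BCT0 DBCT2_le_BCT2)
    show "BCT0 \<alpha> \<le>\<^sub>s\<^sub>W DBCT0 \<alpha>" unfolding BCT0_def DBCT0_def by (rule bct_le_dbct)
    show "BCT2 \<alpha> \<le>\<^sub>s\<^sub>W DBCT2 \<alpha>" unfolding BCT2_def DBCT2_def by (rule bct_le_dbct)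
  qed
qed

end
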